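(* Let $\mathbf{MSLat}$ be the category of meet-semilattices (with top element) and maps preserving finite meets. Let $\mathbf{SCTop}$ be the category whose objects are the sober topological spaces which have a basis of supercompact open sets which is closed under finite intersections and whose arrows are the continuous maps such that the inverse image of any supercompact open set is supercompact. Let $\tilde{A}:\mathbf{MSLat}^{\mathrm{op}}\to\mathbf{SCTop}$ be the functor sending a meet-semilattice $\mathcal{M}$ to the space whose set of points is the collection $\mathcal{F}_{\mathcal{M}}$ of filters on $\mathcal{M}$ and whose open sets are the sets $\{F\in\mathcal{F}_{\mathcal{M}}\mid F\cap I\neq\emptyset\}$ for $I$ a lower set of $\mathcal{M}$, and a homomorphism $f:\mathcal{M}\to\mathcal{N}$ to the map $\mathcal{F}_{\mathcal{N}}\to\mathcal{F}_{\mathcal{M}}$, $F\mapsto f^{-1}(F)$. Let $\tilde{I_A}:\mathbf{SCTop}\to\mathbf{MSLat}^{\mathrm{op}}$ be the functor sending $X$ to the poset of its supercompact open sets and a continuous map $f:X\to Y$ in $\mathbf{SCTop}$ to the restriction of $f^{-1}$ to the posets of supercompact open sets of $Y$ and $X$. Then, via $\tilde{A}$ and $\tilde{I_A}$, the categories $\mathbf{MSLat}$ and $\mathbf{SCTop}$ are dual to each other.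
   Context: A filter on a meet-semilattice $\mathcal{M}$ is an upper set containing the top element and closed under binary meets (the improper filter $\mathcal{M}$ is allowed). An open set $U$ of a space is supercompact if whenever $U=\bigcup_{i\in I}U_i$ with all $U_i$ open ($I$ possibly empty) there is $i\in I$ with $U=U_i$. Finite meets/intersections include the empty one. *)

theory Defs
  imports "HOL-Analysis.Abstract_Topology" "HOL-Algebra.Lattice" "HOL-Library.FuncSet"
begin

section \<open>Categories, functors, equivalences\<close>

text \<open>Hom-sets need not be disjoint, so composition and the action of a functor on arrows
  take the objects involved as extra arguments.\<close>

record ('o, 'm) category =
  Obj :: "'o set"
  Hom :: "'o \<Rightarrow> 'o \<Rightarrow> 'm set"
  Id :: "'o \<Rightarrow> 'm"
  Comp :: "'o \<Rightarrow> 'o \<Rightarrow> 'o \<Rightarrow> 'm \<Rightarrow> 'm \<Rightarrow> 'm"  \<comment> \<open>\<open>Comp C X Y Z g f\<close> is \<open>g\<close> after \<open>f\<close>, for \<open>f : X \<rightarrow> Y\<close> and \<open>g : Y \<rightarrow> Z\<close>\<close>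

definition is_category :: "('o, 'm) category \<Rightarrow> bool" where
  "is_category C \<longleftrightarrow>
     (\<forall>X\<in>Obj C. Id C X \<in> Hom C X X) \<and>
     (\<forall>X\<in>Obj C. \<forall>Y\<in>Obj C. \<forall>Z\<in>Obj C. \<forall>f\<in>Hom C X Y. \<forall>g\<in>Hom C Y Z.
        Comp C X Y Z g f \<in> Hom C X Z) \<and>
     (\<forall>X\<in>Obj C. \<forall>Y\<in>Obj C. \<forall>f\<in>Hom C X Y.
        Comp C X X Y f (Id C X) = f \<and> Comp C X Y Y (Id C Y) f = f) \<and>
     (\<forall>W\<in>Obj C. \<forall>X\<in>Obj C. \<forall>Y\<in>Obj C. \<forall>Z\<in>Obj C.
        \<forall>f\<in>Hom C W X. \<forall>g\<in>Hom C X Y. \<forall>h\<in>Hom C Y Z.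
        Comp C W X Z (Comp C X Y Z h g) f = Comp C W Y Z h (Comp C W X Y g f))"

definition opposite :: "('o, 'm) category \<Rightarrow> ('o, 'm) category" where
  "opposite C = \<lparr>Obj = Obj C, Hom = (\<lambda>X Y. Hom C Y X), Id = Id C,
     Comp = (\<lambda>X Y Z g f. Comp C Z Y X f g)\<rparr>"

record ('o, 'm, 'p, 'n) funct =
  on_obj :: "'o \<Rightarrow> 'p"
  on_hom :: "'o \<Rightarrow> 'o \<Rightarrow> 'm \<Rightarrow> 'n"  \<comment> \<open>\<open>on_hom F X Y f\<close>, for \<open>f : X \<rightarrow> Y\<close>\<close>

definition is_functor ::
  "('o, 'm) category \<Rightarrow> ('p, 'n) category \<Rightarrow> ('o, 'm, 'p, 'n) funct \<Rightarrow> bool" where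
  "is_functor C D F \<longleftrightarrow> is_category C \<and> is_category D \<and>
     (\<forall>X\<in>Obj C. on_obj F X \<in> Obj D) \<and>
     (\<forall>X\<in>Obj C. \<forall>Y\<in>Obj C. \<forall>f\<in>Hom C X Y. on_hom F X Y f \<in> Hom D (on_obj F X) (on_obj F Y)) \<and>
     (\<forall>X\<in>Obj C. on_hom F X X (Id C X) = Id D (on_obj F X)) \<and>
     (\<forall>X\<in>Obj C. \<forall>Y\<in>Obj C. \<forall>Z\<in>Obj C. \<forall>f\<in>Hom C X Y. \<forall>g\<in>Hom C Y Z.
        on_hom F X Z (Comp C X Y Z g f) =
        Comp D (on_obj F X) (on_obj F Y) (on_obj F Z) (on_hom F Y Z g) (on_hom F X Y f))"

definition id_functor :: "('o, 'm, 'o, 'm) funct" where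
  "id_functor = \<lparr>on_obj = (\<lambda>X. X), on_hom = (\<lambda>X Y f. f)\<rparr>"

definition comp_functor ::
  "('p, 'n, 'q, 'k) funct \<Rightarrow> ('o, 'm, 'p, 'n) funct \<Rightarrow> ('o, 'm, 'q, 'k) funct"
  (infixl "\<circ>\<^sub>F" 55) where
  "G \<circ>\<^sub>F F = \<lparr>on_obj = (\<lambda>X. on_obj G (on_obj F X)),
     on_hom = (\<lambda>X Y f. on_hom G (on_obj F X) (on_obj F Y) (on_hom F X Y f))\<rparr>"

definition op_functor :: "('o, 'm, 'p, 'n) funct \<Rightarrow> ('o, 'm, 'p, 'n) funct" where
  "op_functor F = \<lparr>on_obj = on_obj F, on_hom = (\<lambda>X Y. on_hom F Y X)\<rparr>"

definition is_iso :: "('o, 'm) category \<Rightarrow> 'o \<Rightarrow> 'o \<Rightarrow> 'm \<Rightarrow> bool" where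
  "is_iso C X Y f \<longleftrightarrow> f \<in> Hom C X Y \<and>
     (\<exists>g\<in>Hom C Y X. Comp C X Y X g f = Id C X \<and> Comp C Y X Y f g = Id C Y)"

definition nat_isomorphic ::
  "('o, 'm) category \<Rightarrow> ('p, 'n) category \<Rightarrow>
     ('o, 'm, 'p, 'n) funct \<Rightarrow> ('o, 'm, 'p, 'n) funct \<Rightarrow> bool" where
  "nat_isomorphic C D F G \<longleftrightarrow> is_functor C D F \<and> is_functor C D G \<and>
     (\<exists>\<eta>. (\<forall>X\<in>Obj C. is_iso D (on_obj F X) (on_obj G X) (\<eta> X)) \<and>
        (\<forall>X\<in>Obj C. \<forall>Y\<in>Obj C. \<forall>f\<in>Hom C X Y.
           Comp D (on_obj F X) (on_obj F Y) (on_obj G Y) (\<eta> Y) (on_hom F X Y f) =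
           Comp D (on_obj F X) (on_obj G X) (on_obj G Y) (on_hom G X Y f) (\<eta> X)))"

definition equivalence_via ::
  "('o, 'm) category \<Rightarrow> ('p, 'n) category \<Rightarrow>
     ('o, 'm, 'p, 'n) funct \<Rightarrow> ('p, 'n, 'o, 'm) funct \<Rightarrow> bool" where
  "equivalence_via C D F G \<longleftrightarrow> is_functor C D F \<and> is_functor D C G \<and>
     nat_isomorphic C C id_functor (G \<circ>\<^sub>F F) \<and> nat_isomorphic D D (F \<circ>\<^sub>F G) id_functor"


section \<open>Meet-semilattices and filters\<close>

definition meet_semilattice :: "'a gorder \<Rightarrow> bool" where
  "meet_semilattice M \<longleftrightarrow> lower_semilattice M \<and> weak_partial_order_top M"

text \<open>The instance \<open>A = {}\<close> says that the top element is preserved.\<close>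

definition mslat_hom :: "'a gorder \<Rightarrow> 'b gorder \<Rightarrow> ('a \<Rightarrow> 'b) set" where
  "mslat_hom M N = {f \<in> carrier M \<rightarrow>\<^sub>E carrier N.
     \<forall>A. finite A \<and> A \<subseteq> carrier M \<longrightarrow> f (\<Sqinter>\<^bsub>M\<^esub>A) = \<Sqinter>\<^bsub>N\<^esub>(f ` A)}"

text \<open>The parameter \<open>S\<close> is the collection of admissible underlying sets; \<open>UNIV\<close> imposes no
  restriction.\<close>

definition MSLat :: "'a set set \<Rightarrow> ('a gorder, 'a \<Rightarrow> 'a) category" where
  "MSLat S = \<lparr>Obj = {M. meet_semilattice M \<and> carrier M \<in> S}, Hom = mslat_hom,
     Id = (\<lambda>M. \<lambda>x\<in>carrier M. x), Comp = (\<lambda>M N P g f. compose (carrier M) g f)\<rparr>"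

definition lower_set :: "'a gorder \<Rightarrow> 'a set \<Rightarrow> bool" where
  "lower_set M I \<longleftrightarrow> I \<subseteq> carrier M \<and>
     (\<forall>x\<in>I. \<forall>y\<in>carrier M. y \<sqsubseteq>\<^bsub>M\<^esub> x \<longrightarrow> y \<in> I)"

definition upper_set :: "'a gorder \<Rightarrow> 'a set \<Rightarrow> bool" where
  "upper_set M F \<longleftrightarrow> F \<subseteq> carrier M \<and>
     (\<forall>x\<in>F. \<forall>y\<in>carrier M. x \<sqsubseteq>\<^bsub>M\<^esub> y \<longrightarrow> y \<in> F)"

definition filters :: "'a gorder \<Rightarrow> 'a set set" where
  "filters M = {F. upper_set M F \<and> \<top>\<^bsub>M\<^esub> \<in> F \<and> (\<forall>x\<in>F. \<forall>y\<in>F. x \<sqinter>\<^bsub>M\<^esub> y \<in> F)}"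


section \<open>Supercompact opens and the spaces of interest\<close>

definition supercompact_open :: "'a topology \<Rightarrow> 'a set \<Rightarrow> bool" where
  "supercompact_open X U \<longleftrightarrow> openin X U \<and>
     (\<forall>\<U>. (\<forall>V\<in>\<U>. openin X V) \<and> U = \<Union>\<U> \<longrightarrow> U \<in> \<U>)"

definition irreducible_closed :: "'a topology \<Rightarrow> 'a set \<Rightarrow> bool" where
  "irreducible_closed X C \<longleftrightarrow> closedin X C \<and> C \<noteq> {} \<and>
     (\<forall>A B. closedin X A \<and> closedin X B \<and> C = A \<union> B \<longrightarrow> C = A \<or> C = B)"

definition sober_space :: "'a topology \<Rightarrow> bool" where
  "sober_space X \<longleftrightarrow>
     (\<forall>C. irreducible_closed X C \<longrightarrow> (\<exists>!x. x \<in> topspace X \<and> X closure_of {x} = C))"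

text \<open>Intersecting with \<open>topspace X\<close> makes the intersection of the empty family the whole space.\<close>

definition sc_space :: "'a topology \<Rightarrow> bool" where
  "sc_space X \<longleftrightarrow> sober_space X \<and>
     (\<exists>\<B>. (\<forall>B\<in>\<B>. supercompact_open X B) \<and>
          (\<forall>U. openin X U \<longrightarrow> (\<exists>\<U>. \<U> \<subseteq> \<B> \<and> U = \<Union>\<U>)) \<and>
          (\<forall>\<F>. finite \<F> \<and> \<F> \<subseteq> \<B> \<longrightarrow> topspace X \<inter> \<Inter>\<F> \<in> \<B>))"

definition sc_map :: "'a topology \<Rightarrow> 'b topology \<Rightarrow> ('a \<Rightarrow> 'b) set" where
  "sc_map X Y = {f \<in> extensional (topspace X). continuous_map X Y f \<and>
     (\<forall>U. supercompact_open Y U \<longrightarrow> supercompact_open X (f -` U \<inter> topspace X))}"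

definition SCTop :: "'a set set \<Rightarrow> ('a topology, 'a \<Rightarrow> 'a) category" where
  "SCTop S = \<lparr>Obj = {X. sc_space X \<and> topspace X \<in> S}, Hom = sc_map,
     Id = (\<lambda>X. \<lambda>x\<in>topspace X. x), Comp = (\<lambda>X Y Z g f. compose (topspace X) g f)\<rparr>"


section \<open>The two functors\<close>

definition filter_space :: "'a gorder \<Rightarrow> 'a set topology" where
  "filter_space M = topology (\<lambda>V. \<exists>I. lower_set M I \<and> V = {F \<in> filters M. F \<inter> I \<noteq> {}})"

text \<open>A functor on the opposite category of meet-semilattices: an arrow \<open>N \<rightarrow> M\<close> there is a
  homomorphism \<open>f : M \<rightarrow> N\<close>.\<close>

definition A_tilde :: "('a gorder, 'a \<Rightarrow> 'a, 'a set topology, 'a set \<Rightarrow> 'a set) funct" where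
  "A_tilde = \<lparr>on_obj = filter_space,
     on_hom = (\<lambda>N M f. \<lambda>F\<in>filters N. f -` F \<inter> carrier M)\<rparr>"

definition supercompact_poset :: "'a topology \<Rightarrow> 'a set gorder" where
  "supercompact_poset X = \<lparr>carrier = {U. supercompact_open X U}, eq = (=), le = (\<subseteq>)\<rparr>"

definition I_tilde :: "('a topology, 'a \<Rightarrow> 'a, 'a set gorder, 'a set \<Rightarrow> 'a set) funct" where
  "I_tilde = \<lparr>on_obj = supercompact_poset,
     on_hom = (\<lambda>X Y f. \<lambda>U\<in>{U. supercompact_open Y U}. f -` U \<inter> topspace X)\<rparr>"

lemma istopology_filter_space:
  assumes "meet_semilattice M"
  shows "istopology (\<lambda>V. \<exists>I. lower_set M I \<and> V = {F \<in> filters M. F \<inter> I \<noteq> {}})"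
proof -
  interpret lower_semilattice M
    using assms by (simp add: meet_semilattice_def)
  let ?D = "\<lambda>I. {F \<in> filters M. F \<inter> I \<noteq> {}}"
  have int: "?D I \<inter> ?D J = ?D (I \<inter> J)" if I: "lower_set M I" and J: "lower_set M J" for I J
  proof (intro equalityI subsetI)
    fix F assume "F \<in> ?D I \<inter> ?D J"
    then obtain x y where F: "F \<in> filters M" and x: "x \<in> F" "x \<in> I" and y: "y \<in> F" "y \<in> J"
      by blast
    then have carr: "x \<in> carrier M" "y \<in> carrier M"
      using I J by (auto simp: lower_set_def)
    then have "x \<sqinter>\<^bsub>M\<^esub> y \<in> I \<inter> J"
      using I J x y meet_left[OF carr] meet_right[OF carr] meet_closed[OF carr]
      unfolding lower_set_def by blast
    moreover have "x \<sqinter>\<^bsub>M\<^esub> y \<in> F"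
      using F x y by (auto simp: filters_def)
    ultimately show "F \<in> ?D (I \<inter> J)"
      using F by blast
  qed auto
  show ?thesis
    unfolding istopology_def
  proof (intro conjI allI impI)
    fix U V
    assume "\<exists>I. lower_set M I \<and> U = ?D I" "\<exists>I. lower_set M I \<and> V = ?D I"
    then obtain I J where IJ: "lower_set M I" "U = ?D I" "lower_set M J" "V = ?D J"
      by blast
    then have "lower_set M (I \<inter> J)"
      by (auto simp: lower_set_def)
    with IJ int show "\<exists>I. lower_set M I \<and> U \<inter> V = ?D I"
      by blast
  next
    fix \<K> assume "\<forall>K\<in>\<K>. \<exists>I. lower_set M I \<and> K = ?D I"
    then obtain J where J: "\<And>K. K \<in> \<K> \<Longrightarrow> lower_set M (J K) \<and> K = ?D (J K)"
      by metis
    have "lower_set M (\<Union>K\<in>\<K>. J K)"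
      using J unfolding lower_set_def by blast
    moreover have "\<Union>\<K> = ?D (\<Union>K\<in>\<K>. J K)"
      using J by blast
    ultimately show "\<exists>I. lower_set M I \<and> \<Union>\<K> = ?D I"
      by blast
  qed
qed

lemma openin_filter_space:
  assumes "meet_semilattice M"
  shows "openin (filter_space M) V \<longleftrightarrow> (\<exists>I. lower_set M I \<and> V = {F \<in> filters M. F \<inter> I \<noteq> {}})"
  using istopology_filter_space[OF assms] by (simp add: filter_space_def)

lemma topspace_filter_space:
  assumes "meet_semilattice M"
  shows "topspace (filter_space M) = filters M"
proof -
  have "lower_set M (carrier M)"
    by (simp add: lower_set_def)
  moreover have "filters M = {F \<in> filters M. F \<inter> carrier M \<noteq> {}}"
    by (auto simp: filters_def upper_set_def)
  ultimately have "openin (filter_space M) (filters M)"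
    using openin_filter_space[OF assms] by blast
  moreover have "V \<subseteq> filters M" if "openin (filter_space M) V" for V
    using that openin_filter_space[OF assms] by auto
  ultimately show ?thesis
    by (meson openin_subset openin_topspace subset_antisym)
qed


section \<open>Change of underlying set\<close>

text \<open>The points of \<open>filter_space M\<close> have type \<open>'a set\<close> when \<open>M\<close> is a structure on type \<open>'a\<close>,
  and likewise for \<open>supercompact_poset\<close>. So a composite of the two functors changes
  the type, and the identity functor cannot be compared with it directly. What takes its place is
  transport of structure along an injection \<open>r\<close>: the carrier \<open>A\<close> is
  replaced by its copy \<open>r ` A\<close>, and arrows are conjugated by \<open>r\<close>.\<close>

definition transport_fun :: "('a \<Rightarrow> 'b) \<Rightarrow> 'a set \<Rightarrow> ('a \<Rightarrow> 'a) \<Rightarrow> 'b \<Rightarrow> 'b" where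
  "transport_fun r A f = (\<lambda>y\<in>r ` A. r (f (inv_into A r y)))"

definition transport_MSLat :: "('a \<Rightarrow> 'b) \<Rightarrow> ('a gorder, 'a \<Rightarrow> 'a, 'b gorder, 'b \<Rightarrow> 'b) funct" where
  "transport_MSLat r = \<lparr>
     on_obj = (\<lambda>M. \<lparr>carrier = r ` carrier M, eq = (=),
        le = (\<lambda>x y. inv_into (carrier M) r x \<sqsubseteq>\<^bsub>M\<^esub> inv_into (carrier M) r y)\<rparr>),
     on_hom = (\<lambda>M N. transport_fun r (carrier M))\<rparr>"

definition transport_SCTop ::
  "('a \<Rightarrow> 'b) \<Rightarrow> ('a topology, 'a \<Rightarrow> 'a, 'b topology, 'b \<Rightarrow> 'b) funct" where
  "transport_SCTop r = \<lparr>
     on_obj = (\<lambda>X. pullback_topology (r ` topspace X) (inv_into (topspace X) r) X),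
     on_hom = (\<lambda>X Y. transport_fun r (topspace X))\<rparr>"

text \<open>A collection \<open>S\<close> of small subsets of a type \<open>'u\<close>, closed under subsets and power sets, where
  \<open>e\<close> codes small sets injectively as elements of \<open>'u\<close> (in a set-theoretic universe, \<open>e\<close> sends
  the extension of a set to that set). Transport along \<open>e\<close> brings \<open>filter_space M\<close> and
  \<open>supercompact_poset X\<close> back to \<open>'u\<close>.\<close>

definition small_universe :: "'u set set \<Rightarrow> ('u set \<Rightarrow> 'u) \<Rightarrow> bool" where
  "small_universe S e \<longleftrightarrow> inj_on e S \<and> (\<forall>A\<in>S. Pow A \<subseteq> S \<and> e ` Pow A \<in> S)"

end

theory Submission
  imports Defs
begin

text \<open>
  A meet-semilattice \<open>M\<close> can be read off its space of filters. To an element \<open>x\<close> belongs the basic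
  open set of all filters that contain \<open>x\<close>. Its least point is the principal filter of \<open>x\<close>, and
  an open set that contains the principal filter contains the whole basic open set. So the basic
  open sets are supercompact; as they form a basis, they are all the supercompact opens
  (\<open>supercompact_open_filter_space_iff\<close>). Inclusion between them is the order of \<open>M\<close> and
  intersection is the meet, which gives the isomorphism \<open>poset_iso_filters_containing\<close> of \<open>M\<close> with
  the supercompact opens of its space of filters. That space is sober: the generic point of an
  irreducible closed set \<open>C\<close> of filters is the union of \<open>C\<close> (\<open>sober_filter_space\<close>).

  In the other direction, let \<open>X\<close> be sober with a basis of supercompact opens closed under finite
  intersections. The basis consists of all supercompact opens (\<open>sc_space_iff\<close>), which are therefore
  a meet-semilattice. The supercompact neighbourhoods of a point form a filter, which determines
  the point because sober spaces are \<open>T\<^sub>0\<close>. Every filter \<open>F\<close> arises in this way: remove from \<open>X\<close> all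
  supercompact opens outside \<open>F\<close>. What remains is irreducible, since the supercompact opens that
  meet it are precisely the members of \<open>F\<close>, and its generic point has \<open>F\<close> as its neighbourhood
  filter (\<open>supercompact_nhds_surj\<close>). This bijection is the homeomorphism
  \<open>homeomorphic_map_supercompact_nhds\<close>.

  Both functors act on arrows by preimages, so naturality of these two isomorphisms is a matter of
  unfolding membership (\<open>vimage_filters_containing\<close>, \<open>vimage_supercompact_nhds\<close>). They connect
  structures on different types, however. They are therefore stated as order isomorphisms and
  homeomorphisms, and \<open>nat_isomorphic_concrete\<close> turns two natural families of such bijections with
  a common source into a natural isomorphism between their targets. Transport along an injection
  is one such family, and it commutes with taking preimages (\<open>transport_fun_vimage_image\<close>);
  this gives the comparison with plain transport as well as the equivalence on a universe of
  small sets.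
\<close>

section \<open>Concrete categories\<close>

text \<open>Both categories consist of sets with structure and of structure-preserving functions,
  extensional outside their domain. \<open>U\<close> is the underlying-set functor; everything that
  concerns only identities and composition follows from this much.\<close>

definition concrete_category :: "('o \<Rightarrow> 'a set) \<Rightarrow> ('o, 'a \<Rightarrow> 'a) category \<Rightarrow> bool" where
  "concrete_category U C \<longleftrightarrow>
     (\<forall>X\<in>Obj C. \<forall>Y\<in>Obj C. Hom C X Y \<subseteq> U X \<rightarrow>\<^sub>E U Y) \<and>
     (\<forall>X\<in>Obj C. Id C X = (\<lambda>x\<in>U X. x) \<and> Id C X \<in> Hom C X X) \<and>
     (\<forall>X\<in>Obj C. \<forall>Y\<in>Obj C. \<forall>Z\<in>Obj C. \<forall>f\<in>Hom C X Y. \<forall>g\<in>Hom C Y Z.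
        Comp C X Y Z g f = compose (U X) g f \<and> compose (U X) g f \<in> Hom C X Z)"

lemma concrete_category_Hom:
  assumes "concrete_category U C" "X \<in> Obj C" "Y \<in> Obj C" "f \<in> Hom C X Y"
  shows "f \<in> U X \<rightarrow>\<^sub>E U Y"
  using assms unfolding concrete_category_def by blast

lemma concrete_category_Id:
  assumes "concrete_category U C" "X \<in> Obj C"
  shows "Id C X = (\<lambda>x\<in>U X. x)" "Id C X \<in> Hom C X X"
  using assms unfolding concrete_category_def by blast+

lemma concrete_category_Comp:
  assumes "concrete_category U C" "X \<in> Obj C" "Y \<in> Obj C" "Z \<in> Obj C"
    and "f \<in> Hom C X Y" "g \<in> Hom C Y Z"
  shows "Comp C X Y Z g f = compose (U X) g f" "compose (U X) g f \<in> Hom C X Z"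
  using assms unfolding concrete_category_def by blast+

lemma is_category_concrete:
  assumes C: "concrete_category U C"
  shows "is_category C"
  unfolding is_category_def
proof (intro conjI ballI)
  fix X assume X: "X \<in> Obj C"
  show "Id C X \<in> Hom C X X"
    by (rule concrete_category_Id[OF C X])
next
  fix X Y Z f g
  assume "X \<in> Obj C" "Y \<in> Obj C" "Z \<in> Obj C" "f \<in> Hom C X Y" "g \<in> Hom C Y Z"
  then show "Comp C X Y Z g f \<in> Hom C X Z"
    using concrete_category_Comp[OF C] by simp
next
  fix X Y f assume X: "X \<in> Obj C" and Y: "Y \<in> Obj C" and f: "f \<in> Hom C X Y"
  have "f \<in> U X \<rightarrow>\<^sub>E U Y"
    by (rule concrete_category_Hom[OF C X Y f])
  then have "f \<in> U X \<rightarrow> U Y" "f \<in> extensional (U X)"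
    by (simp_all add: PiE_def)
  then have "compose (U X) f (\<lambda>x\<in>U X. x) = f" "compose (U X) (\<lambda>x\<in>U Y. x) f = f"
    by (rule compose_Id, rule Id_compose)
  then show "Comp C X X Y f (Id C X) = f" "Comp C X Y Y (Id C Y) f = f"
    using concrete_category_Comp[OF C] concrete_category_Id[OF C] X Y f by simp_all
next
  fix W X Y Z f g h
  assume W: "W \<in> Obj C" and X: "X \<in> Obj C" and Y: "Y \<in> Obj C" and Z: "Z \<in> Obj C"
    and f: "f \<in> Hom C W X" and g: "g \<in> Hom C X Y" and h: "h \<in> Hom C Y Z"
  have "f \<in> U W \<rightarrow> U X"
    using concrete_category_Hom[OF C W X f] by auto
  then show "Comp C W X Z (Comp C X Y Z h g) f = Comp C W Y Z h (Comp C W X Y g f)"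
    using concrete_category_Comp[OF C] W X Y Z f g h by (simp add: compose_assoc[symmetric])
qed

text \<open>Natural isomorphisms between functors into a concrete category are assembled from
  bijections \<open>\<alpha>\<close> and \<open>\<beta>\<close> that start in the underlying sets of the source category: there
  the points can be named, and naturality is a computation with points. The underlying type of
  the source may differ from that of the target, as it does when the functors are composites
  of \<open>A_tilde\<close> and \<open>I_tilde\<close>.\<close>

lemma nat_isomorphic_concrete:
  assumes C: "concrete_category U C" and D: "concrete_category V D"
    and F: "is_functor C D F" and G: "is_functor C D G"
    and \<alpha>: "\<And>X. X \<in> Obj C \<Longrightarrow> bij_betw (\<alpha> X) (U X) (V (on_obj F X))"
    and \<beta>: "\<And>X. X \<in> Obj C \<Longrightarrow> bij_betw (\<beta> X) (U X) (V (on_obj G X))"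
    and FG: "\<And>X. X \<in> Obj C \<Longrightarrow>
      (\<lambda>y\<in>V (on_obj F X). \<beta> X (inv_into (U X) (\<alpha> X) y)) \<in> Hom D (on_obj F X) (on_obj G X)"
    and GF: "\<And>X. X \<in> Obj C \<Longrightarrow>
      (\<lambda>y\<in>V (on_obj G X). \<alpha> X (inv_into (U X) (\<beta> X) y)) \<in> Hom D (on_obj G X) (on_obj F X)"
    and nat_\<alpha>: "\<And>X Y f x. X \<in> Obj C \<Longrightarrow> Y \<in> Obj C \<Longrightarrow> f \<in> Hom C X Y \<Longrightarrow> x \<in> U X \<Longrightarrow>
      on_hom F X Y f (\<alpha> X x) = \<alpha> Y (f x)"
    and nat_\<beta>: "\<And>X Y f x. X \<in> Obj C \<Longrightarrow> Y \<in> Obj C \<Longrightarrow> f \<in> Hom C X Y \<Longrightarrow> x \<in> U X \<Longrightarrow>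
      on_hom G X Y f (\<beta> X x) = \<beta> Y (f x)"
  shows "nat_isomorphic C D F G"
proof -
  let ?\<eta> = "\<lambda>X. \<lambda>y\<in>V (on_obj F X). \<beta> X (inv_into (U X) (\<alpha> X) y)"
  let ?\<theta> = "\<lambda>X. \<lambda>y\<in>V (on_obj G X). \<alpha> X (inv_into (U X) (\<beta> X) y)"
  have FX: "on_obj F X \<in> Obj D" and GX: "on_obj G X \<in> Obj D" if "X \<in> Obj C" for X
    using F G that unfolding is_functor_def by blast+
  have \<alpha>V: "\<alpha> X x \<in> V (on_obj F X)" and \<beta>V: "\<beta> X x \<in> V (on_obj G X)"
    and \<eta>\<alpha>: "?\<eta> X (\<alpha> X x) = \<beta> X x" and \<theta>\<beta>: "?\<theta> X (\<beta> X x) = \<alpha> X x"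
    if "X \<in> Obj C" "x \<in> U X" for X x
    using \<alpha>[OF that(1)] \<beta>[OF that(1)] that(2)
    by (auto simp: bij_betw_inv_into_left bij_betwE)
  have \<alpha>E: "\<exists>x\<in>U X. y = \<alpha> X x" if "X \<in> Obj C" "y \<in> V (on_obj F X)" for X y
    using \<alpha>[OF that(1)] that(2) by (auto simp: bij_betw_def)
  have \<beta>E: "\<exists>x\<in>U X. y = \<beta> X x" if "X \<in> Obj C" "y \<in> V (on_obj G X)" for X y
    using \<beta>[OF that(1)] that(2) by (auto simp: bij_betw_def)
  have "is_iso D (on_obj F X) (on_obj G X) (?\<eta> X)" if X: "X \<in> Obj C" for X
  proof -
    have "compose (V (on_obj F X)) (?\<theta> X) (?\<eta> X) = (\<lambda>y\<in>V (on_obj F X). y)"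
    proof (rule extensionalityI[of _ "V (on_obj F X)"])
      fix y assume "y \<in> V (on_obj F X)"
      then show "compose (V (on_obj F X)) (?\<theta> X) (?\<eta> X) y = (\<lambda>y\<in>V (on_obj F X). y) y"
        using \<alpha>E[OF X] \<eta>\<alpha>[OF X] \<theta>\<beta>[OF X] by (metis (no_types, lifting) compose_eq restrict_apply')
    qed auto
    moreover have "compose (V (on_obj G X)) (?\<eta> X) (?\<theta> X) = (\<lambda>y\<in>V (on_obj G X). y)"
    proof (rule extensionalityI[of _ "V (on_obj G X)"])
      fix y assume "y \<in> V (on_obj G X)"
      then show "compose (V (on_obj G X)) (?\<eta> X) (?\<theta> X) y = (\<lambda>y\<in>V (on_obj G X). y) y"
        using \<beta>E[OF X] \<eta>\<alpha>[OF X] \<theta>\<beta>[OF X] by (metis (no_types, lifting) compose_eq restrict_apply')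
    qed auto
    ultimately show ?thesis
      unfolding is_iso_def
      using FG[OF X] GF[OF X] concrete_category_Comp(1)[OF D] concrete_category_Id(1)[OF D]
        FX[OF X] GX[OF X] by (intro conjI bexI[of _ "?\<theta> X"]) simp_all
  qed
  moreover have "Comp D (on_obj F X) (on_obj F Y) (on_obj G Y) (?\<eta> Y) (on_hom F X Y f) =
      Comp D (on_obj F X) (on_obj G X) (on_obj G Y) (on_hom G X Y f) (?\<eta> X)"
    if X: "X \<in> Obj C" and Y: "Y \<in> Obj C" and f: "f \<in> Hom C X Y" for X Y f
  proof -
    have Ff: "on_hom F X Y f \<in> Hom D (on_obj F X) (on_obj F Y)"
      and Gf: "on_hom G X Y f \<in> Hom D (on_obj G X) (on_obj G Y)"
      using F G X Y f unfolding is_functor_def by blast+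
    have "compose (V (on_obj F X)) (?\<eta> Y) (on_hom F X Y f) =
        compose (V (on_obj F X)) (on_hom G X Y f) (?\<eta> X)"
    proof (rule extensionalityI[of _ "V (on_obj F X)"])
      fix y assume "y \<in> V (on_obj F X)"
      then obtain x where x: "x \<in> U X" "y = \<alpha> X x"
        using \<alpha>E[OF X] by blast
      have "f x \<in> U Y"
        using concrete_category_Hom[OF C X Y f] x by auto
      then show "compose (V (on_obj F X)) (?\<eta> Y) (on_hom F X Y f) y =
          compose (V (on_obj F X)) (on_hom G X Y f) (?\<eta> X) y"
        using x \<alpha>V[OF X] \<eta>\<alpha>[OF X x(1)] \<eta>\<alpha>[OF Y] nat_\<alpha>[OF X Y f] nat_\<beta>[OF X Y f]
        by (simp add: compose_eq)
    qed auto
    then show ?thesis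
      using concrete_category_Comp(1)[OF D] FX GX X Y Ff Gf FG by simp
  qed
  ultimately show ?thesis
    unfolding nat_isomorphic_def using F G by (intro conjI exI[of _ ?\<eta>]) auto
qed

lemma transport_fun_apply:
  assumes "inj_on r A" "x \<in> A"
  shows "transport_fun r A f (r x) = r (f x)"
  using assms by (simp add: transport_fun_def)

text \<open>Conjugation by bijections is functorial no matter what the structure is; only the
  membership of the conjugates in the target category depends on it.\<close>

lemma is_functor_transport:
  assumes C: "concrete_category U C" and D: "concrete_category V D"
    and obj: "\<And>X. X \<in> Obj C \<Longrightarrow> on_obj T X \<in> Obj D"
    and bij: "\<And>X. X \<in> Obj C \<Longrightarrow> bij_betw r (U X) (V (on_obj T X))"
    and hom_eq: "\<And>X Y f. on_hom T X Y f = transport_fun r (U X) f"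
    and hom: "\<And>X Y f. X \<in> Obj C \<Longrightarrow> Y \<in> Obj C \<Longrightarrow> f \<in> Hom C X Y \<Longrightarrow>
      transport_fun r (U X) f \<in> Hom D (on_obj T X) (on_obj T Y)"
  shows "is_functor C D T"
proof -
  have V: "V (on_obj T X) = r ` U X" and inj: "inj_on r (U X)" if "X \<in> Obj C" for X
    using bij[OF that] by (auto simp: bij_betw_def)
  show ?thesis
    unfolding is_functor_def
  proof (intro conjI ballI is_category_concrete[OF C] is_category_concrete[OF D])
    fix X assume X: "X \<in> Obj C"
    show "on_obj T X \<in> Obj D"
      by (rule obj[OF X])
    show "on_hom T X X (Id C X) = Id D (on_obj T X)"
      unfolding hom_eq concrete_category_Id(1)[OF C X] concrete_category_Id(1)[OF D obj[OF X]] V[OF X]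
      using inj[OF X] by (auto simp: transport_fun_def fun_eq_iff)
  next
    fix X Y f assume "X \<in> Obj C" "Y \<in> Obj C" "f \<in> Hom C X Y"
    then show "on_hom T X Y f \<in> Hom D (on_obj T X) (on_obj T Y)"
      unfolding hom_eq by (rule hom)
  next
    fix X Y Z f g
    assume X: "X \<in> Obj C" and Y: "Y \<in> Obj C" and Z: "Z \<in> Obj C"
      and f: "f \<in> Hom C X Y" and g: "g \<in> Hom C Y Z"
    have fU: "f x \<in> U Y" if "x \<in> U X" for x
      using concrete_category_Hom[OF C X Y f] that by auto
    have "transport_fun r (U X) (compose (U X) g f) =
        compose (r ` U X) (transport_fun r (U Y) g) (transport_fun r (U X) f)"
    proof (rule extensionalityI[of _ "r ` U X"])
      fix y assume "y \<in> r ` U X"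
      then show "transport_fun r (U X) (compose (U X) g f) y =
          compose (r ` U X) (transport_fun r (U Y) g) (transport_fun r (U X) f) y"
        using inj[OF X] inj[OF Y] fU by (auto simp: compose_eq transport_fun_apply)
    qed (auto simp: transport_fun_def)
    then show "on_hom T X Z (Comp C X Y Z g f) =
        Comp D (on_obj T X) (on_obj T Y) (on_obj T Z) (on_hom T Y Z g) (on_hom T X Y f)"
      using concrete_category_Comp(1)[OF C X Y Z f g] hom[OF X Y f] hom[OF Y Z g]
        concrete_category_Comp(1)[OF D obj[OF X] obj[OF Y] obj[OF Z]]
      by (simp add: hom_eq V[OF X])
  qed
qed

lemma is_functor_comp:
  assumes "is_functor C D F" "is_functor D E G"
  shows "is_functor C E (G \<circ>\<^sub>F F)"
  using assms unfolding is_functor_def comp_functor_def by simp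

lemma is_functor_id: "is_category C \<Longrightarrow> is_functor C C id_functor"
  by (simp add: is_functor_def id_functor_def is_category_def)

lemma opposite_opposite: "opposite (opposite C) = C"
  by (simp add: opposite_def)

lemma op_functor_op_functor: "op_functor (op_functor F) = F"
  by (simp add: op_functor_def)

lemma op_functor_id: "op_functor id_functor = id_functor"
  by (simp add: op_functor_def id_functor_def)

lemma is_category_opposite: "is_category C \<Longrightarrow> is_category (opposite C)"
  unfolding is_category_def opposite_def by simp

lemma is_functor_op:
  assumes "is_functor C D F"
  shows "is_functor (opposite C) (opposite D) (op_functor F)"
  using assms is_category_opposite[of C] is_category_opposite[of D]
  unfolding is_functor_def by (simp add: opposite_def op_functor_def)

text \<open>Reversing arrows reverses the direction of a natural transformation.\<close>

lemma nat_isomorphic_op: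
  assumes "nat_isomorphic C D F G"
  shows "nat_isomorphic (opposite C) (opposite D) (op_functor G) (op_functor F)"
proof -
  obtain \<eta> where \<eta>: "\<forall>X\<in>Obj C. is_iso D (on_obj F X) (on_obj G X) (\<eta> X)"
    "\<forall>X\<in>Obj C. \<forall>Y\<in>Obj C. \<forall>f\<in>Hom C X Y.
       Comp D (on_obj F X) (on_obj F Y) (on_obj G Y) (\<eta> Y) (on_hom F X Y f) =
       Comp D (on_obj F X) (on_obj G X) (on_obj G Y) (on_hom G X Y f) (\<eta> X)"
    using assms unfolding nat_isomorphic_def by blast
  have "\<forall>X\<in>Obj C. is_iso (opposite D) (on_obj G X) (on_obj F X) (\<eta> X)"
    using \<eta>(1) by (auto simp: is_iso_def opposite_def)
  then show ?thesis
    unfolding nat_isomorphic_def using \<eta>(2) assms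
    by (intro conjI exI[of _ \<eta>] is_functor_op)
      (simp_all add: nat_isomorphic_def opposite_def op_functor_def)
qed

section \<open>Meet-semilattices\<close>

text \<open>The condition for a greatest lower bound, as an equivalence: in this form it is invariant under
  order isomorphisms for trivial reasons. For \<open>A = {}\<close> it says that \<open>g\<close> is the top element.\<close>

definition is_meet :: "'a gorder \<Rightarrow> 'a set \<Rightarrow> 'a \<Rightarrow> bool" where
  "is_meet M A g \<longleftrightarrow> g \<in> carrier M \<and>
     (\<forall>y\<in>carrier M. y \<sqsubseteq>\<^bsub>M\<^esub> g \<longleftrightarrow> (\<forall>a\<in>A. y \<sqsubseteq>\<^bsub>M\<^esub> a))"

lemma greatest_Lower_imp_is_meet:
  assumes "weak_partial_order M" "A \<subseteq> carrier M" "greatest M g (Lower M A)"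
  shows "is_meet M A g"
proof -
  interpret weak_partial_order M by (rule assms(1))
  have g: "g \<in> carrier M" "\<And>a. a \<in> A \<Longrightarrow> g \<sqsubseteq>\<^bsub>M\<^esub> a"
    using assms(2,3) by (auto simp: greatest_def Lower_def)
  have "y \<sqsubseteq>\<^bsub>M\<^esub> a" if "y \<in> carrier M" "y \<sqsubseteq>\<^bsub>M\<^esub> g" "a \<in> A" for y a
    using le_trans[of y g a] that g assms(2) by auto
  moreover have "y \<sqsubseteq>\<^bsub>M\<^esub> g" if "y \<in> carrier M" "\<forall>a\<in>A. y \<sqsubseteq>\<^bsub>M\<^esub> a" for y
    using assms(3) that by (auto simp: greatest_def Lower_def)
  ultimately show ?thesis
    using g unfolding is_meet_def by blast
qed

lemma is_meet_imp_greatest_Lower: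
  assumes "weak_partial_order M" "A \<subseteq> carrier M" "is_meet M A g"
  shows "greatest M g (Lower M A)"
proof -
  interpret weak_partial_order M by (rule assms(1))
  show ?thesis
    using assms(2,3) by (auto simp: greatest_def Lower_def is_meet_def)
qed

lemma meet_semilatticeI:
  assumes eq: "eq M = (=)"
    and refl: "\<And>x. x \<in> carrier M \<Longrightarrow> x \<sqsubseteq>\<^bsub>M\<^esub> x"
    and antisym: "\<And>x y. x \<in> carrier M \<Longrightarrow> y \<in> carrier M \<Longrightarrow> x \<sqsubseteq>\<^bsub>M\<^esub> y \<Longrightarrow> y \<sqsubseteq>\<^bsub>M\<^esub> x \<Longrightarrow> x = y"
    and trans: "\<And>x y z. x \<in> carrier M \<Longrightarrow> y \<in> carrier M \<Longrightarrow> z \<in> carrier M \<Longrightarrow>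
      x \<sqsubseteq>\<^bsub>M\<^esub> y \<Longrightarrow> y \<sqsubseteq>\<^bsub>M\<^esub> z \<Longrightarrow> x \<sqsubseteq>\<^bsub>M\<^esub> z"
    and meets: "\<And>A. finite A \<Longrightarrow> A \<subseteq> carrier M \<Longrightarrow> \<exists>g. is_meet M A g"
  shows "meet_semilattice M"
proof -
  interpret weak_partial_order M
    by unfold_locales (auto simp: eq intro: refl dest: antisym trans)
  have greatest: "\<exists>g. greatest M g (Lower M A)" if "finite A" "A \<subseteq> carrier M" for A
    using meets[OF that] is_meet_imp_greatest_Lower[OF weak_partial_order_axioms that(2)] by blast
  have "lower_semilattice M"
    by unfold_locales (use eq greatest in auto)
  moreover have "weak_partial_order_top M"
    by unfold_locales (use greatest[of "{}"] in auto)
  ultimately show ?thesis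
    by (simp add: meet_semilattice_def)
qed

lemma Inf_empty_eq_top: "\<Sqinter>\<^bsub>M\<^esub>{} = \<top>\<^bsub>M\<^esub>"
  by (simp add: inf_def top_def)

context
  fixes M :: "'a gorder"
  assumes M: "meet_semilattice M"
begin

interpretation lower_semilattice M
  using M by (simp add: meet_semilattice_def)

interpretation weak_partial_order_top M
  using M by (simp add: meet_semilattice_def)

lemma meet_semilattice_refl: "x \<in> carrier M \<Longrightarrow> x \<sqsubseteq>\<^bsub>M\<^esub> x"
  by (rule le_refl)

lemma meet_semilattice_antisym:
  "x \<in> carrier M \<Longrightarrow> y \<in> carrier M \<Longrightarrow> x \<sqsubseteq>\<^bsub>M\<^esub> y \<Longrightarrow> y \<sqsubseteq>\<^bsub>M\<^esub> x \<Longrightarrow> x = y"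
  by (rule le_antisym)

lemma meet_semilattice_trans:
  "x \<in> carrier M \<Longrightarrow> y \<in> carrier M \<Longrightarrow> z \<in> carrier M \<Longrightarrow> x \<sqsubseteq>\<^bsub>M\<^esub> y \<Longrightarrow> y \<sqsubseteq>\<^bsub>M\<^esub> z \<Longrightarrow> x \<sqsubseteq>\<^bsub>M\<^esub> z"
  using le_trans by blast

lemma is_meet_Inf:
  assumes "finite A" "A \<subseteq> carrier M"
  shows "is_meet M A (\<Sqinter>\<^bsub>M\<^esub>A)"
proof (rule greatest_Lower_imp_is_meet[OF weak_partial_order_axioms assms(2)])
  show "greatest M (\<Sqinter>\<^bsub>M\<^esub>A) (Lower M A)"
  proof (cases "A = {}")
    case True
    then show ?thesis
      using top_greatest by (simp add: Inf_empty_eq_top)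
  next
    case False
    then show ?thesis
      using finite_inf_greatest assms by blast
  qed
qed

lemma Inf_eq_is_meet:
  assumes "finite A" "A \<subseteq> carrier M" "is_meet M A g"
  shows "\<Sqinter>\<^bsub>M\<^esub>A = g"
  using is_meet_Inf[OF assms(1,2)] assms(3) le_antisym le_refl
  unfolding is_meet_def by metis

lemma top_carrier: "\<top>\<^bsub>M\<^esub> \<in> carrier M"
  by simp

lemma le_top: "x \<in> carrier M \<Longrightarrow> x \<sqsubseteq>\<^bsub>M\<^esub> \<top>\<^bsub>M\<^esub>"
  by simp

lemma meet_carrier: "x \<in> carrier M \<Longrightarrow> y \<in> carrier M \<Longrightarrow> x \<sqinter>\<^bsub>M\<^esub> y \<in> carrier M"
  by simp

lemma le_meet_iff:
  assumes "x \<in> carrier M" "y \<in> carrier M" "z \<in> carrier M"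
  shows "z \<sqsubseteq>\<^bsub>M\<^esub> x \<sqinter>\<^bsub>M\<^esub> y \<longleftrightarrow> z \<sqsubseteq>\<^bsub>M\<^esub> x \<and> z \<sqsubseteq>\<^bsub>M\<^esub> y"
  using is_meet_Inf[of "{x, y}"] assms by (auto simp: is_meet_def meet_def)

lemma meet_eq_iff:
  assumes "x \<in> carrier M" "y \<in> carrier M"
  shows "x \<sqinter>\<^bsub>M\<^esub> y = x \<longleftrightarrow> x \<sqsubseteq>\<^bsub>M\<^esub> y"
  using le_meet_iff[OF assms assms(1)] le_meet_iff[OF assms meet_carrier[OF assms]]
    le_antisym[OF _ _ meet_carrier[OF assms] assms(1)] assms
    le_refl[OF assms(1)] le_refl[OF meet_carrier[OF assms]] by metis

end

subsection \<open>Homomorphisms and isomorphisms\<close>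

lemma mslat_hom_PiE: "f \<in> mslat_hom M N \<Longrightarrow> f \<in> carrier M \<rightarrow>\<^sub>E carrier N"
  by (simp add: mslat_hom_def)

lemma mslat_hom_Inf:
  "f \<in> mslat_hom M N \<Longrightarrow> finite A \<Longrightarrow> A \<subseteq> carrier M \<Longrightarrow> f (\<Sqinter>\<^bsub>M\<^esub>A) = \<Sqinter>\<^bsub>N\<^esub>(f ` A)"
  by (simp add: mslat_hom_def)

lemma mslat_hom_top:
  assumes "f \<in> mslat_hom M N"
  shows "f \<top>\<^bsub>M\<^esub> = \<top>\<^bsub>N\<^esub>"
  using mslat_hom_Inf[OF assms, of "{}"] by (simp add: Inf_empty_eq_top)

lemma mslat_hom_meet:
  assumes "f \<in> mslat_hom M N" "x \<in> carrier M" "y \<in> carrier M"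
  shows "f (x \<sqinter>\<^bsub>M\<^esub> y) = f x \<sqinter>\<^bsub>N\<^esub> f y"
  using mslat_hom_Inf[OF assms(1), of "{x, y}"] assms by (simp add: meet_def)

lemma mslat_hom_mono:
  assumes M: "meet_semilattice M" and N: "meet_semilattice N" and f: "f \<in> mslat_hom M N"
    and xy: "x \<in> carrier M" "y \<in> carrier M" "x \<sqsubseteq>\<^bsub>M\<^esub> y"
  shows "f x \<sqsubseteq>\<^bsub>N\<^esub> f y"
proof -
  have "f x \<in> carrier N" "f y \<in> carrier N"
    using mslat_hom_PiE[OF f] xy by auto
  moreover have "f x \<sqinter>\<^bsub>N\<^esub> f y = f x"
    using mslat_hom_meet[OF f xy(1,2)] meet_eq_iff[OF M xy(1,2)] xy(3) by simp
  ultimately show ?thesis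
    using meet_eq_iff[OF N] by blast
qed

lemma mslat_hom_compose:
  assumes f: "f \<in> mslat_hom M N" and g: "g \<in> mslat_hom N P" and M: "meet_semilattice M"
  shows "compose (carrier M) g f \<in> mslat_hom M P"
proof -
  have fM: "f \<in> carrier M \<rightarrow> carrier N" and gN: "g \<in> carrier N \<rightarrow> carrier P"
    using f g by (auto simp: mslat_hom_def)
  have "compose (carrier M) g f (\<Sqinter>\<^bsub>M\<^esub>A) = \<Sqinter>\<^bsub>P\<^esub>(compose (carrier M) g f ` A)"
    if A: "finite A" "A \<subseteq> carrier M" for A
  proof -
    have "\<Sqinter>\<^bsub>M\<^esub>A \<in> carrier M"
      using is_meet_Inf[OF M A] by (simp add: is_meet_def)
    moreover have "f ` A \<subseteq> carrier N"
      using A fM by blast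
    moreover have "compose (carrier M) g f ` A = g ` f ` A"
      using A by (force simp: compose_def)
    ultimately show ?thesis
      using mslat_hom_Inf[OF f A] mslat_hom_Inf[OF g, of "f ` A"] A(1) by (simp add: compose_eq)
  qed
  then show ?thesis
    using funcset_compose[OF fM gN] by (auto simp: mslat_hom_def PiE_def)
qed

text \<open>Unlike an isomorphism in the category of meet-semilattices, this notion compares structures on
  different types; the units of the duality are of this kind. Meets are preserved because they
  are determined by the order.\<close>

definition poset_iso :: "'a gorder \<Rightarrow> 'b gorder \<Rightarrow> ('a \<Rightarrow> 'b) \<Rightarrow> bool" where
  "poset_iso M N \<phi> \<longleftrightarrow> bij_betw \<phi> (carrier M) (carrier N) \<and>
     (\<forall>x\<in>carrier M. \<forall>y\<in>carrier M. \<phi> x \<sqsubseteq>\<^bsub>N\<^esub> \<phi> y \<longleftrightarrow> x \<sqsubseteq>\<^bsub>M\<^esub> y)"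

lemma poset_iso_carrier: "poset_iso M N \<phi> \<Longrightarrow> x \<in> carrier M \<Longrightarrow> \<phi> x \<in> carrier N"
  by (auto simp: poset_iso_def bij_betw_def)

lemma poset_iso_le:
  "poset_iso M N \<phi> \<Longrightarrow> x \<in> carrier M \<Longrightarrow> y \<in> carrier M \<Longrightarrow> \<phi> x \<sqsubseteq>\<^bsub>N\<^esub> \<phi> y \<longleftrightarrow> x \<sqsubseteq>\<^bsub>M\<^esub> y"
  by (simp add: poset_iso_def)

lemma poset_iso_inverse:
  assumes "poset_iso M N \<phi>"
  shows "poset_iso N M (inv_into (carrier M) \<phi>)"
proof -
  have bij: "bij_betw \<phi> (carrier M) (carrier N)"
    using assms by (simp add: poset_iso_def)
  show ?thesis
    unfolding poset_iso_def
  proof (intro conjI ballI bij_betw_inv_into[OF bij])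
    fix x y assume "x \<in> carrier N" "y \<in> carrier N"
    then show "inv_into (carrier M) \<phi> x \<sqsubseteq>\<^bsub>M\<^esub> inv_into (carrier M) \<phi> y \<longleftrightarrow> x \<sqsubseteq>\<^bsub>N\<^esub> y"
      using poset_iso_le[OF assms, of "inv_into (carrier M) \<phi> x" "inv_into (carrier M) \<phi> y"]
        bij_betw_inv_into_right[OF bij] bij_betwE[OF bij_betw_inv_into[OF bij]] by simp
  qed
qed

lemma poset_iso_comp:
  assumes "poset_iso M N \<phi>" "poset_iso N P \<psi>"
  shows "poset_iso M P (\<psi> \<circ> \<phi>)"
  using assms poset_iso_carrier[OF assms(1)] unfolding poset_iso_def
  by (auto intro: bij_betw_trans)

lemma poset_iso_is_meet:
  assumes "poset_iso M N \<phi>" "A \<subseteq> carrier M" "is_meet M A g"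
  shows "is_meet N (\<phi> ` A) (\<phi> g)"
proof -
  have "carrier N = \<phi> ` carrier M"
    using assms(1) by (simp add: poset_iso_def bij_betw_def)
  moreover have "g \<in> carrier M"
    using assms(3) by (simp add: is_meet_def)
  moreover have "\<phi> y \<sqsubseteq>\<^bsub>N\<^esub> \<phi> x \<longleftrightarrow> y \<sqsubseteq>\<^bsub>M\<^esub> x" if "x \<in> A \<or> x = g" "y \<in> carrier M" for x y
    using poset_iso_le[OF assms(1)] that assms(2) \<open>g \<in> carrier M\<close> by blast
  ultimately show ?thesis
    using assms(3) unfolding is_meet_def by simp
qed

lemma meet_semilattice_poset_iso:
  assumes M: "meet_semilattice M" and \<phi>: "poset_iso M N \<phi>" and eq: "eq N = (=)"
  shows "meet_semilattice N"
proof -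
  define \<psi> where "\<psi> = inv_into (carrier M) \<phi>"
  have \<psi>: "poset_iso N M \<psi>"
    unfolding \<psi>_def by (rule poset_iso_inverse[OF \<phi>])
  have \<psi>M: "\<psi> x \<in> carrier M" if "x \<in> carrier N" for x
    by (rule poset_iso_carrier[OF \<psi> that])
  have inj: "inj_on \<psi> (carrier N)"
    using \<psi> by (simp add: poset_iso_def bij_betw_def)
  have le: "x \<sqsubseteq>\<^bsub>N\<^esub> y \<longleftrightarrow> \<psi> x \<sqsubseteq>\<^bsub>M\<^esub> \<psi> y" if "x \<in> carrier N" "y \<in> carrier N" for x y
    using poset_iso_le[OF \<psi> that] by simp
  show ?thesis
  proof (rule meet_semilatticeI[OF eq])
    fix A assume A: "finite A" "A \<subseteq> carrier N"
    then have "finite (\<psi> ` A)" "\<psi> ` A \<subseteq> carrier M"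
      using \<psi>M by auto
    then have "is_meet N (\<phi> ` \<psi> ` A) (\<phi> (\<Sqinter>\<^bsub>M\<^esub>(\<psi> ` A)))"
      using poset_iso_is_meet[OF \<phi>] is_meet_Inf[OF M] by blast
    then show "\<exists>g. is_meet N A g" 
      using A(2) \<phi> image_inv_into_cancel[of \<phi> "carrier M" "carrier N" A]
      by (auto simp: \<psi>_def poset_iso_def bij_betw_def)
  next
    fix x assume "x \<in> carrier N"
    then show "x \<sqsubseteq>\<^bsub>N\<^esub> x"
      using le \<psi>M meet_semilattice_refl[OF M] by simp
  next
    fix x y assume "x \<in> carrier N" "y \<in> carrier N" "x \<sqsubseteq>\<^bsub>N\<^esub> y" "y \<sqsubseteq>\<^bsub>N\<^esub> x"
    then show "x = y"
      using le \<psi>M meet_semilattice_antisym[OF M] inj by (simp add: inj_on_def)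
  next
    fix x y z
    assume "x \<in> carrier N" "y \<in> carrier N" "z \<in> carrier N" "x \<sqsubseteq>\<^bsub>N\<^esub> y" "y \<sqsubseteq>\<^bsub>N\<^esub> z"
    then show "x \<sqsubseteq>\<^bsub>N\<^esub> z"
      using le \<psi>M meet_semilattice_trans[OF M, of "\<psi> x" "\<psi> y" "\<psi> z"] by simp
  qed
qed

lemma poset_iso_mslat_hom:
  assumes M: "meet_semilattice M" and N: "meet_semilattice N" and \<phi>: "poset_iso M N \<phi>"
  shows "restrict \<phi> (carrier M) \<in> mslat_hom M N"
proof -
  have "restrict \<phi> (carrier M) (\<Sqinter>\<^bsub>M\<^esub>A) = \<Sqinter>\<^bsub>N\<^esub>(restrict \<phi> (carrier M) ` A)"
    if A: "finite A" "A \<subseteq> carrier M" for A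
  proof -
    have "is_meet M A (\<Sqinter>\<^bsub>M\<^esub>A)"
      by (rule is_meet_Inf[OF M A])
    then have "\<Sqinter>\<^bsub>N\<^esub>(\<phi> ` A) = \<phi> (\<Sqinter>\<^bsub>M\<^esub>A)"
      using poset_iso_is_meet[OF \<phi> A(2)] Inf_eq_is_meet[OF N, of "\<phi> ` A"] A poset_iso_carrier[OF \<phi>]
      by blast
    moreover have "restrict \<phi> (carrier M) ` A = \<phi> ` A"
      using A(2) by force
    ultimately show ?thesis
      using \<open>is_meet M A (\<Sqinter>\<^bsub>M\<^esub>A)\<close> by (simp add: is_meet_def)
  qed
  then show ?thesis
    using poset_iso_carrier[OF \<phi>] by (auto simp: mslat_hom_def)
qed

lemma concrete_category_MSLat: "concrete_category carrier (MSLat S)"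
  unfolding concrete_category_def
proof (intro conjI ballI)
  fix M :: "'a gorder" assume "M \<in> Obj (MSLat S)"
  then have M: "meet_semilattice M"
    by (simp add: MSLat_def)
  have "poset_iso M M (\<lambda>x. x)"
    by (simp add: poset_iso_def bij_betw_def)
  then show "Id (MSLat S) M \<in> Hom (MSLat S) M M"
    using poset_iso_mslat_hom[OF M M] by (simp add: MSLat_def)
qed (auto simp: MSLat_def intro: mslat_hom_compose dest: mslat_hom_PiE)

lemma poset_iso_transport:
  assumes "inj_on r (carrier M)"
  shows "poset_iso M (on_obj (transport_MSLat r) M) r"
  using assms by (simp add: poset_iso_def transport_MSLat_def bij_betw_def)

lemma meet_semilattice_transport:
  assumes "meet_semilattice M" "inj_on r (carrier M)"
  shows "meet_semilattice (on_obj (transport_MSLat r) M)"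
  by (rule meet_semilattice_poset_iso[OF assms(1) poset_iso_transport[OF assms(2)]])
    (simp add: transport_MSLat_def)

lemma is_functor_transport_MSLat:
  fixes r :: "'a \<Rightarrow> 'b"
  assumes S: "\<And>A. A \<in> S \<Longrightarrow> inj_on r A" "\<And>A. A \<in> S \<Longrightarrow> r ` A \<in> S'"
  shows "is_functor (MSLat S) (MSLat S') (transport_MSLat r)"
proof (rule is_functor_transport[OF concrete_category_MSLat concrete_category_MSLat])
  fix M :: "'a gorder" assume "M \<in> Obj (MSLat S)"
  then have M: "meet_semilattice M" and A: "carrier M \<in> S"
    by (auto simp: MSLat_def)
  show "on_obj (transport_MSLat r) M \<in> Obj (MSLat S')"
    using meet_semilattice_transport[OF M S(1)[OF A]] S(2)[OF A]
    by (simp add: MSLat_def) (simp add: transport_MSLat_def)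
  show "bij_betw r (carrier M) (carrier (on_obj (transport_MSLat r) M))"
    using poset_iso_transport[OF S(1)[OF A]] by (simp add: poset_iso_def)
  fix N :: "'a gorder" and f assume "N \<in> Obj (MSLat S)" and "f \<in> Hom (MSLat S) M N"
  then have N: "meet_semilattice N" and B: "carrier N \<in> S" and f: "f \<in> mslat_hom M N"
    by (auto simp: MSLat_def)
  let ?T = "on_obj (transport_MSLat r)"
  let ?i = "restrict (inv_into (carrier M) r) (carrier (?T M))"
  have "?i \<in> mslat_hom (?T M) M"
    using poset_iso_mslat_hom meet_semilattice_transport[OF M S(1)[OF A]] M
      poset_iso_inverse[OF poset_iso_transport[OF S(1)[OF A]]] by blast
  moreover have "restrict r (carrier N) \<in> mslat_hom N (?T N)"
    using poset_iso_mslat_hom meet_semilattice_transport[OF N S(1)[OF B]] N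
      poset_iso_transport[OF S(1)[OF B]] by blast
  ultimately have "compose (carrier (?T M)) (restrict r (carrier N))
      (compose (carrier (?T M)) f ?i) \<in> mslat_hom (?T M) (?T N)"
    by (intro mslat_hom_compose[OF mslat_hom_compose[OF _ f]]
        meet_semilattice_transport[OF M S(1)[OF A]])
  also have "compose (carrier (?T M)) (restrict r (carrier N))
      (compose (carrier (?T M)) f ?i) = transport_fun r (carrier M) f"
  proof -
    have "carrier (?T M) = r ` carrier M"
      by (simp add: transport_MSLat_def)
    moreover have "f x \<in> carrier N" if "x \<in> carrier M" for x
      using mslat_hom_PiE[OF f] that by auto
    ultimately show ?thesis
      by (auto simp: transport_fun_def compose_def fun_eq_iff inv_into_into)
  qed
  finally show "transport_fun r (carrier M) f \<in> Hom (MSLat S') (?T M) (?T N)"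
    by (simp add: MSLat_def)
qed (simp add: transport_MSLat_def)

section \<open>Supercompact opens and sober spaces\<close>

lemma supercompact_open_openin: "supercompact_open X U \<Longrightarrow> openin X U"
  by (simp add: supercompact_open_def)

lemma supercompact_open_subset: "supercompact_open X U \<Longrightarrow> U \<subseteq> topspace X"
  by (simp add: supercompact_open_def openin_subset)

text \<open>Supercompactness is primality for unions: cut the members of the cover down to \<open>U\<close>.\<close>

lemma supercompact_open_cover:
  assumes U: "supercompact_open X U" and \<V>: "\<And>V. V \<in> \<V> \<Longrightarrow> openin X V" and "U \<subseteq> \<Union>\<V>"
  shows "\<exists>V\<in>\<V>. U \<subseteq> V"
proof -
  have "\<forall>W\<in>(\<inter>) U ` \<V>. openin X W"
    using \<V> supercompact_open_openin[OF U] by auto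
  moreover have "U = \<Union>((\<inter>) U ` \<V>)"
    using \<open>U \<subseteq> \<Union>\<V>\<close> by auto
  ultimately have "U \<in> (\<inter>) U ` \<V>"
    using U unfolding supercompact_open_def by blast
  then show ?thesis
    by blast
qed

lemma supercompact_open_Inter:
  assumes "supercompact_open X (topspace X)"
    and "\<And>U V. supercompact_open X U \<Longrightarrow> supercompact_open X V \<Longrightarrow> supercompact_open X (U \<inter> V)"
    and "finite \<F>" "\<F> \<subseteq> Collect (supercompact_open X)"
  shows "supercompact_open X (topspace X \<inter> \<Inter>\<F>)"
  using assms(3,4)
proof induction
  case empty
  then show ?case
    using assms(1) by simp
next
  case (insert V \<F>)
  have "topspace X \<inter> \<Inter>(insert V \<F>) = V \<inter> (topspace X \<inter> \<Inter>\<F>)"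
    by auto
  then show ?case
    using insert assms(2) by simp
qed

text \<open>A supercompact open set is a member of any family of open sets of which it is the union, so
  a basis as in the definition of the spaces under consideration contains, and hence is, the
  collection of all supercompact opens.\<close>

lemma sc_space_iff:
  "sc_space X \<longleftrightarrow> sober_space X \<and> supercompact_open X (topspace X) \<and>
     (\<forall>U V. supercompact_open X U \<and> supercompact_open X V \<longrightarrow> supercompact_open X (U \<inter> V)) \<and>
     (\<forall>U x. openin X U \<and> x \<in> U \<longrightarrow> (\<exists>V. supercompact_open X V \<and> x \<in> V \<and> V \<subseteq> U))"
  (is "?L \<longleftrightarrow> ?R")
proof
  assume ?L
  then obtain \<B> where sober: "sober_space X" and \<B>: "\<forall>B\<in>\<B>. supercompact_open X B"
    and basis: "\<forall>U. openin X U \<longrightarrow> (\<exists>\<U>. \<U> \<subseteq> \<B> \<and> U = \<Union>\<U>)"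
    and int: "\<forall>\<F>. finite \<F> \<and> \<F> \<subseteq> \<B> \<longrightarrow> topspace X \<inter> \<Inter>\<F> \<in> \<B>"
    unfolding sc_space_def by (elim conjE exE) (rule that)
  have \<B>_eq: "U \<in> \<B>" if U: "supercompact_open X U" for U
  proof -
    obtain \<U> where \<U>: "\<U> \<subseteq> \<B>" "U = \<Union>\<U>"
      using basis supercompact_open_openin[OF U] by meson
    then have "\<forall>V\<in>\<U>. openin X V"
      using \<B> by (auto intro: supercompact_open_openin)
    then show ?thesis
      using U \<U> unfolding supercompact_open_def by blast
  qed
  have "supercompact_open X (topspace X)"
    using int[rule_format, of "{}"] \<B> by simp
  moreover have "supercompact_open X (U \<inter> V)"
    if "supercompact_open X U" "supercompact_open X V" for U V
  proof -
    have "topspace X \<inter> \<Inter>{U, V} = U \<inter> V"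
      using supercompact_open_subset that by fastforce
    then show ?thesis
      using int[rule_format, of "{U, V}"] \<B> \<B>_eq that by simp
  qed
  moreover have "\<exists>V. supercompact_open X V \<and> x \<in> V \<and> V \<subseteq> U" if U: "openin X U" "x \<in> U" for U x
  proof -
    obtain \<U> where "\<U> \<subseteq> \<B>" "U = \<Union>\<U>"
      using basis U(1) by meson
    then show ?thesis
      using \<B> U(2) by blast
  qed
  ultimately show ?R
    using sober by blast
next
  assume R: ?R
  have "\<exists>\<U>. \<U> \<subseteq> Collect (supercompact_open X) \<and> U = \<Union>\<U>" if U: "openin X U" for U
  proof (intro exI[of _ "{V. supercompact_open X V \<and> V \<subseteq> U}"] conjI equalityI subsetI)
    fix x assume "x \<in> U"
    then show "x \<in> \<Union>{V. supercompact_open X V \<and> V \<subseteq> U}"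
      using R U by blast
  qed auto
  moreover have "supercompact_open X (topspace X \<inter> \<Inter>\<F>)"
    if "finite \<F>" "\<F> \<subseteq> Collect (supercompact_open X)" for \<F>
    using R that by (intro supercompact_open_Inter) simp_all
  ultimately show ?L
    unfolding sc_space_def using R by (intro conjI exI[of _ "Collect (supercompact_open X)"]) auto
qed

lemma sc_space_supercompact_Inter:
  assumes "sc_space X" "finite \<F>" "\<F> \<subseteq> Collect (supercompact_open X)"
  shows "supercompact_open X (topspace X \<inter> \<Inter>\<F>)"
  using assms supercompact_open_Inter[of X \<F>] by (simp add: sc_space_iff)

text \<open>Irreducibility in terms of open sets: any two open sets that meet \<open>C\<close> meet inside \<open>C\<close>.
  It suffices to test the members of a basis.\<close>

lemma irreducible_closed_Int:
  assumes C: "irreducible_closed X C" and U: "openin X U" "U \<inter> C \<noteq> {}"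
    and V: "openin X V" "V \<inter> C \<noteq> {}"
  shows "U \<inter> V \<inter> C \<noteq> {}"
proof
  assume "U \<inter> V \<inter> C = {}"
  then have "C = (C - U) \<union> (C - V)"
    by blast
  moreover have "closedin X (C - U)" "closedin X (C - V)"
    using C U V by (auto simp: irreducible_closed_def intro: closedin_diff)
  ultimately have "C = C - U \<or> C = C - V"
    using C unfolding irreducible_closed_def by blast
  then show False
    using U(2) V(2) by blast
qed

lemma irreducible_closedI:
  assumes closed: "closedin X C" and "C \<noteq> {}"
    and basis: "\<And>U x. openin X U \<Longrightarrow> x \<in> U \<Longrightarrow> \<exists>V. P V \<and> x \<in> V \<and> V \<subseteq> U"
    and P: "\<And>U V. P U \<Longrightarrow> P V \<Longrightarrow> U \<inter> C \<noteq> {} \<Longrightarrow> V \<inter> C \<noteq> {} \<Longrightarrow> U \<inter> V \<inter> C \<noteq> {}"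
  shows "irreducible_closed X C"
  unfolding irreducible_closed_def
proof (intro conjI allI impI assms)
  fix A B assume AB: "closedin X A \<and> closedin X B \<and> C = A \<union> B"
  show "C = A \<or> C = B"
  proof (rule ccontr)
    assume "\<not> (C = A \<or> C = B)"
    then obtain a b where a: "a \<in> C" "a \<notin> A" and b: "b \<in> C" "b \<notin> B"
      using AB by blast
    have "openin X (topspace X - A)" "openin X (topspace X - B)"
      using AB by auto
    moreover have "a \<in> topspace X - A" "b \<in> topspace X - B"
      using a b closedin_subset[OF closed] by auto
    ultimately obtain U V where U: "P U" "a \<in> U" "U \<subseteq> topspace X - A"
      and V: "P V" "b \<in> V" "V \<subseteq> topspace X - B"
      using basis by meson
    then have "U \<inter> V \<inter> C \<noteq> {}"
      using P[of U V] a(1) b(1) by blast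
    then show False
      using U(3) V(3) AB by blast
  qed
qed

lemma irreducible_closed_closure_of_singleton:
  assumes x: "x \<in> topspace X"
  shows "irreducible_closed X (X closure_of {x})"
proof (rule irreducible_closedI[where P = "openin X"])
  show "X closure_of {x} \<noteq> {}"
    using x by (simp add: closure_of_eq_empty)
  have meets: "x \<in> U" if "openin X U" "U \<inter> X closure_of {x} \<noteq> {}" for U
    using that by (auto simp: in_closure_of)
  show "U \<inter> V \<inter> X closure_of {x} \<noteq> {}"
    if "openin X U" "openin X V" "U \<inter> X closure_of {x} \<noteq> {}" "V \<inter> X closure_of {x} \<noteq> {}" for U V
    using meets[OF that(1,3)] meets[OF that(2,4)] x by (auto simp: in_closure_of)
qed auto

text \<open>A sober space is a \<open>T\<^sub>0\<close> space, since the closure of a point is irreducible.\<close>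

lemma sober_space_closure_inj:
  assumes "sober_space X" "x \<in> topspace X" "y \<in> topspace X" "X closure_of {x} = X closure_of {y}"
  shows "x = y"
  using assms irreducible_closed_closure_of_singleton[OF assms(2)] unfolding sober_space_def by metis

subsection \<open>Invariance under homeomorphisms\<close>

lemma homeomorphic_map_inverse:
  assumes "homeomorphic_map X Y h"
  shows "homeomorphic_map Y X (inv_into (topspace X) h)"
proof -
  obtain g where g: "homeomorphic_maps X Y h g"
    using assms homeomorphic_map_maps by blast
  have "g y = inv_into (topspace X) h y" if y: "y \<in> topspace Y" for y
  proof -
    have "g y \<in> topspace X" "h (g y) = y"
      using g y by (auto simp: homeomorphic_maps_def continuous_map_def)
    then show ?thesis
      using homeomorphic_imp_injective_map[OF assms] by (metis inv_into_f_f)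
  qed
  moreover have "homeomorphic_map Y X g"
    using g by (simp add: homeomorphic_maps_map)
  ultimately show ?thesis
    by (rule homeomorphic_map_eq[rotated])
qed

lemma homeomorphic_map_image_inverse:
  assumes h: "homeomorphic_map X Y h"
  shows "V \<subseteq> topspace Y \<Longrightarrow> h ` inv_into (topspace X) h ` V = V"
    and "U \<subseteq> topspace X \<Longrightarrow> inv_into (topspace X) h ` h ` U = U"
    and "V \<subseteq> topspace Y \<Longrightarrow> inv_into (topspace X) h ` V = h -` V \<inter> topspace X"
proof -
  have im: "h ` topspace X = topspace Y" and inj: "inj_on h (topspace X)"
    using homeomorphic_imp_surjective_map[OF h] homeomorphic_imp_injective_map[OF h] by simp_all
  show 1: "h ` inv_into (topspace X) h ` V = V" if "V \<subseteq> topspace Y" for V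
    using that im by (simp add: image_inv_into_cancel)
  show 2: "inv_into (topspace X) h ` h ` U = U" if "U \<subseteq> topspace X" for U
    using that inj by (simp add: inv_into_image_cancel)
  assume V: "V \<subseteq> topspace Y"
  then have "V = h ` (h -` V \<inter> topspace X)"
    unfolding im[symmetric] by blast
  then show "inv_into (topspace X) h ` V = h -` V \<inter> topspace X"
    using 2[of "h -` V \<inter> topspace X"] by simp
qed

lemma supercompact_open_homeomorphic_image:
  assumes h: "homeomorphic_map X Y h" and U: "supercompact_open X U"
  shows "supercompact_open Y (h ` U)"
proof -
  let ?g = "inv_into (topspace X) h"
  have g: "homeomorphic_map Y X ?g"
    by (rule homeomorphic_map_inverse[OF h])
  have sub: "U \<subseteq> topspace X"
    by (rule supercompact_open_subset[OF U])
  have "h ` U \<in> \<V>" if \<V>: "\<forall>V\<in>\<V>. openin Y V" "h ` U = \<Union>\<V>" for \<V>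
  proof -
    have "\<forall>W\<in>(`) ?g ` \<V>. openin X W"
      using \<V>(1) homeomorphic_map_openness_eq[OF g] by auto
    moreover have "U = \<Union>((`) ?g ` \<V>)"
      using homeomorphic_map_image_inverse(2)[OF h sub] \<V>(2) by (metis image_Union)
    ultimately have "U \<in> (`) ?g ` \<V>"
      using U unfolding supercompact_open_def by blast
    then obtain V where "V \<in> \<V>" "U = ?g ` V"
      by blast
    then show ?thesis
      using homeomorphic_map_image_inverse(1)[OF h] \<V>(1) openin_subset by metis
  qed
  then show ?thesis
    using homeomorphic_map_openness[OF h sub] supercompact_open_openin[OF U]
    by (simp add: supercompact_open_def)
qed

lemma irreducible_closed_homeomorphic_image:
  assumes h: "homeomorphic_map X Y h" and C: "irreducible_closed X C"
  shows "irreducible_closed Y (h ` C)"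
proof -
  let ?g = "inv_into (topspace X) h"
  have g: "homeomorphic_map Y X ?g"
    by (rule homeomorphic_map_inverse[OF h])
  have sub: "C \<subseteq> topspace X"
    using C by (simp add: irreducible_closed_def closedin_subset)
  have "h ` C = A \<or> h ` C = B" if "closedin Y A" "closedin Y B" "h ` C = A \<union> B" for A B
  proof -
    have "C = ?g ` A \<union> ?g ` B"
      using homeomorphic_map_image_inverse(2)[OF h sub] that(3) by (metis image_Un)
    moreover have "closedin X (?g ` A)" "closedin X (?g ` B)"
      using that homeomorphic_map_closedness_eq[OF g] by auto
    ultimately have "C = ?g ` A \<or> C = ?g ` B"
      using C unfolding irreducible_closed_def by blast
    then show ?thesis
      using homeomorphic_map_image_inverse(1)[OF h] that closedin_subset by metis
  qed
  then show ?thesis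
    using C homeomorphic_map_closedness[OF h sub] by (auto simp: irreducible_closed_def)
qed

lemma sober_space_homeomorphic:
  assumes h: "homeomorphic_map X Y h" and X: "sober_space X"
  shows "sober_space Y"
  unfolding sober_space_def
proof (intro allI impI)
  fix C assume C: "irreducible_closed Y C"
  let ?g = "inv_into (topspace X) h"
  have g: "homeomorphic_map Y X ?g"
    by (rule homeomorphic_map_inverse[OF h])
  have sub: "C \<subseteq> topspace Y"
    using C by (simp add: irreducible_closed_def closedin_subset)
  obtain x where x: "x \<in> topspace X" "X closure_of {x} = ?g ` C"
    using X irreducible_closed_homeomorphic_image[OF g C] unfolding sober_space_def by blast
  show "\<exists>!y. y \<in> topspace Y \<and> Y closure_of {y} = C"
  proof (rule ex1I[of _ "h x"])
    have "Y closure_of {h x} = h ` (X closure_of {x})"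
      using homeomorphic_map_closure_of[OF h, of "{x}"] x(1) by simp
    then show "h x \<in> topspace Y \<and> Y closure_of {h x} = C"
      using x homeomorphic_map_image_inverse(1)[OF h sub] homeomorphic_imp_surjective_map[OF h]
      by auto
  next
    fix y assume y: "y \<in> topspace Y \<and> Y closure_of {y} = C"
    then have "X closure_of {?g y} = ?g ` C"
      using homeomorphic_map_closure_of[OF g, of "{y}"] by simp
    moreover have "?g y \<in> topspace X"
      using y homeomorphic_imp_surjective_map[OF g] by blast
    ultimately have "?g y = x"
      using x sober_space_closure_inj[OF X] by metis
    then show "y = h x"
      using y homeomorphic_imp_surjective_map[OF h] by (metis f_inv_into_f)
  qed
qed

lemma sc_space_homeomorphic:
  assumes h: "homeomorphic_map X Y h" and X: "sc_space X"
  shows "sc_space Y"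
proof -
  let ?g = "inv_into (topspace X) h"
  have g: "homeomorphic_map Y X ?g"
    by (rule homeomorphic_map_inverse[OF h])
  have sc: "supercompact_open Y V \<longleftrightarrow> V \<subseteq> topspace Y \<and> supercompact_open X (?g ` V)" for V
    using supercompact_open_homeomorphic_image[OF g] supercompact_open_subset
      supercompact_open_homeomorphic_image[OF h] homeomorphic_map_image_inverse(1)[OF h] by metis
  have "sober_space Y"
    using sober_space_homeomorphic[OF h] X by (simp add: sc_space_iff)
  moreover have "supercompact_open Y (topspace Y)"
    using X sc homeomorphic_imp_surjective_map[OF g] by (simp add: sc_space_iff)
  moreover have "supercompact_open Y (U \<inter> V)"
    if "supercompact_open Y U" "supercompact_open Y V" for U V
  proof -
    have "?g ` (U \<inter> V) = ?g ` U \<inter> ?g ` V"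
      using homeomorphic_imp_injective_map[OF g] that sc by (intro inj_on_image_Int) auto
    then show ?thesis
      using X that sc[of U] sc[of V] sc[of "U \<inter> V"] by (auto simp: sc_space_iff)
  qed
  moreover have "\<exists>V. supercompact_open Y V \<and> y \<in> V \<and> V \<subseteq> U" if U: "openin Y U" "y \<in> U" for U y
  proof -
    have "openin X (?g ` U)" "?g y \<in> ?g ` U"
      using U homeomorphic_map_openness_eq[OF g] by auto
    then obtain V where V: "supercompact_open X V" "?g y \<in> V" "V \<subseteq> ?g ` U"
      using X unfolding sc_space_iff by meson
    have sub: "U \<subseteq> topspace Y"
      using openin_subset[OF U(1)] .
    have "h ` V \<subseteq> U"
      using V(3) homeomorphic_map_image_inverse(1)[OF h sub] by blast
    moreover have "y = h (?g y)"
      using sub U(2) homeomorphic_imp_surjective_map[OF h] by (metis f_inv_into_f subsetD)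
    then have "y \<in> h ` V"
      using V(2) by blast
    ultimately show ?thesis
      using supercompact_open_homeomorphic_image[OF h V(1)] by blast
  qed
  ultimately show ?thesis
    by (simp add: sc_space_iff)
qed

subsection \<open>Maps\<close>

lemma sc_map_PiE: "f \<in> sc_map X Y \<Longrightarrow> f \<in> topspace X \<rightarrow>\<^sub>E topspace Y"
  by (simp add: sc_map_def PiE_def continuous_map_def)

lemma sc_map_compose:
  assumes f: "f \<in> sc_map X Y" and g: "g \<in> sc_map Y Z"
  shows "compose (topspace X) g f \<in> sc_map X Z"
proof -
  have "continuous_map X Y f" "continuous_map Y Z g"
    using f g by (simp_all add: sc_map_def)
  then have "continuous_map X Z (g \<circ> f)"
    by (rule continuous_map_compose)
  then have "continuous_map X Z (compose (topspace X) g f)"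
    by (rule continuous_map_eq) (simp add: compose_eq)
  moreover have "compose (topspace X) g f -` U \<inter> topspace X =
      f -` (g -` U \<inter> topspace Y) \<inter> topspace X" for U
    using sc_map_PiE[OF f] by (auto simp: compose_eq)
  ultimately show ?thesis
    using f g by (simp add: sc_map_def del: vimage_Int)
qed

lemma homeomorphic_map_sc_map:
  assumes h: "homeomorphic_map X Y h"
  shows "restrict h (topspace X) \<in> sc_map X Y"
proof -
  have "continuous_map X Y (restrict h (topspace X))"
    using homeomorphic_imp_continuous_map[OF h] by (rule continuous_map_eq) simp
  moreover have "supercompact_open X (restrict h (topspace X) -` U \<inter> topspace X)"
    if U: "supercompact_open Y U" for U
  proof -
    have "restrict h (topspace X) -` U \<inter> topspace X = inv_into (topspace X) h ` U"
      unfolding homeomorphic_map_image_inverse(3)[OF h supercompact_open_subset[OF U]] by auto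
    then show ?thesis
      using supercompact_open_homeomorphic_image[OF homeomorphic_map_inverse[OF h] U] by simp
  qed
  ultimately show ?thesis
    by (simp add: sc_map_def)
qed

lemma concrete_category_SCTop: "concrete_category topspace (SCTop S)"
  unfolding concrete_category_def
proof (intro conjI ballI)
  fix X :: "'a topology"
  have "homeomorphic_map X X (\<lambda>x. x)"
    using homeomorphic_map_id[of X X] by (simp add: id_def)
  then show "Id (SCTop S) X \<in> Hom (SCTop S) X X"
    using homeomorphic_map_sc_map by (auto simp: SCTop_def)
qed (auto simp: SCTop_def intro: sc_map_compose dest: sc_map_PiE)

lemma homeomorphic_map_transport:
  assumes r: "inj_on r (topspace X)"
  shows "homeomorphic_map X (on_obj (transport_SCTop r) X) r"
proof -
  let ?T = "on_obj (transport_SCTop r) X"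
  have "inv_into (topspace X) r -` U \<inter> r ` topspace X = r ` U" if "U \<subseteq> topspace X" for U
    using r that by (auto simp: inv_into_f_f)
  then have openin_T: "openin ?T V \<longleftrightarrow> (\<exists>U. openin X U \<and> V = r ` U)" for V
    unfolding transport_SCTop_def by (simp add: openin_pullback_topology) (metis openin_subset)
  have top: "topspace ?T = r ` topspace X"
    using r by (auto simp: transport_SCTop_def topspace_pullback_topology)
  show ?thesis
  proof (rule bijective_open_imp_homeomorphic_map)
    have "{x \<in> topspace X. r x \<in> r ` U} = U" if "openin X U" for U
      using r openin_subset[OF that] by (auto simp: inj_on_def)
    then show "continuous_map X ?T r"
      unfolding continuous_map_def openin_T top by auto
    show "open_map X ?T r"
      unfolding open_map_def openin_T by blast
  qed (use r top in auto)
qed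

lemma is_functor_transport_SCTop:
  fixes r :: "'a \<Rightarrow> 'b"
  assumes S: "\<And>A. A \<in> S \<Longrightarrow> inj_on r A" "\<And>A. A \<in> S \<Longrightarrow> r ` A \<in> S'"
  shows "is_functor (SCTop S) (SCTop S') (transport_SCTop r)"
proof (rule is_functor_transport[OF concrete_category_SCTop concrete_category_SCTop])
  let ?T = "on_obj (transport_SCTop r)"
  fix X :: "'a topology" assume "X \<in> Obj (SCTop S)"
  then have X: "sc_space X" and A: "topspace X \<in> S"
    by (auto simp: SCTop_def)
  have hX: "homeomorphic_map X (?T X) r"
    by (rule homeomorphic_map_transport[OF S(1)[OF A]])
  have top: "topspace (?T X) = r ` topspace X"
    using homeomorphic_imp_surjective_map[OF hX] by simp
  show "?T X \<in> Obj (SCTop S')"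
    using sc_space_homeomorphic[OF hX X] S(2)[OF A] by (simp add: SCTop_def top)
  show "bij_betw r (topspace X) (topspace (?T X))"
    using S(1)[OF A] by (simp add: bij_betw_def top)
  fix Y :: "'a topology" and f assume "Y \<in> Obj (SCTop S)" and "f \<in> Hom (SCTop S) X Y"
  then have B: "topspace Y \<in> S" and f: "f \<in> sc_map X Y"
    by (auto simp: SCTop_def)
  let ?i = "restrict (inv_into (topspace X) r) (topspace (?T X))"
  have "?i \<in> sc_map (?T X) X"
    by (rule homeomorphic_map_sc_map[OF homeomorphic_map_inverse[OF hX]])
  moreover have "restrict r (topspace Y) \<in> sc_map Y (?T Y)"
    by (rule homeomorphic_map_sc_map[OF homeomorphic_map_transport[OF S(1)[OF B]]])
  ultimately have "compose (topspace (?T X)) (restrict r (topspace Y))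
      (compose (topspace (?T X)) f ?i) \<in> sc_map (?T X) (?T Y)"
    by (intro sc_map_compose[OF sc_map_compose[OF _ f]])
  also have "compose (topspace (?T X)) (restrict r (topspace Y))
      (compose (topspace (?T X)) f ?i) = transport_fun r (topspace X) f"
  proof -
    have "f x \<in> topspace Y" if "x \<in> topspace X" for x
      using sc_map_PiE[OF f] that by auto
    then show ?thesis
      by (auto simp: top transport_fun_def compose_def fun_eq_iff inv_into_into)
  qed
  finally show "transport_fun r (topspace X) f \<in> Hom (SCTop S') (?T X) (?T Y)"
    by (simp add: SCTop_def)
qed (simp add: transport_SCTop_def)

section \<open>The semilattice of supercompact opens\<close>

lemma supercompact_poset_simps [simp]:
  "carrier (supercompact_poset X) = {U. supercompact_open X U}"
  "eq (supercompact_poset X) = (=)"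
  "U \<sqsubseteq>\<^bsub>supercompact_poset X\<^esub> V \<longleftrightarrow> U \<subseteq> V"
  by (simp_all add: supercompact_poset_def)

lemma is_meet_supercompact_poset:
  assumes X: "sc_space X" and A: "finite A" "A \<subseteq> carrier (supercompact_poset X)"
  shows "is_meet (supercompact_poset X) A (topspace X \<inter> \<Inter>A)"
  using sc_space_supercompact_Inter[OF X A(1)] A(2) supercompact_open_subset
  by (fastforce simp: is_meet_def)

lemma meet_semilattice_supercompact_poset:
  assumes "sc_space X"
  shows "meet_semilattice (supercompact_poset X)"
  using is_meet_supercompact_poset[OF assms] by (intro meet_semilatticeI) auto

lemma Inf_supercompact_poset:
  assumes "sc_space X" "finite A" "A \<subseteq> carrier (supercompact_poset X)"
  shows "\<Sqinter>\<^bsub>supercompact_poset X\<^esub>A = topspace X \<inter> \<Inter>A"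
  using Inf_eq_is_meet[OF meet_semilattice_supercompact_poset[OF assms(1)] assms(2,3)]
    is_meet_supercompact_poset[OF assms] by simp

lemma meet_supercompact_poset:
  assumes "sc_space X" "supercompact_open X U" "supercompact_open X V"
  shows "U \<sqinter>\<^bsub>supercompact_poset X\<^esub> V = U \<inter> V"
  using Inf_supercompact_poset[OF assms(1), of "{U, V}"] assms(2,3) supercompact_open_subset[of X U]
  by (auto simp: meet_def)

lemma top_supercompact_poset:
  assumes "sc_space X"
  shows "\<top>\<^bsub>supercompact_poset X\<^esub> = topspace X"
  using Inf_supercompact_poset[OF assms, of "{}"] by (simp add: Inf_empty_eq_top)

lemma I_tilde_simps:
  "on_obj I_tilde X = supercompact_poset X"
  "on_hom I_tilde X Y f = (\<lambda>U\<in>{U. supercompact_open Y U}. f -` U \<inter> topspace X)"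
  by (simp_all add: I_tilde_def)

lemma I_tilde_hom:
  assumes X: "sc_space X" and Y: "sc_space Y" and f: "f \<in> sc_map X Y"
  shows "on_hom I_tilde X Y f \<in> mslat_hom (supercompact_poset Y) (supercompact_poset X)"
proof -
  let ?h = "on_hom I_tilde X Y f"
  have pre: "supercompact_open X (f -` U \<inter> topspace X)" if "supercompact_open Y U" for U
    using f that by (simp add: sc_map_def)
  have "?h (\<Sqinter>\<^bsub>supercompact_poset Y\<^esub>A) = \<Sqinter>\<^bsub>supercompact_poset X\<^esub>(?h ` A)"
    if A: "finite A" "A \<subseteq> carrier (supercompact_poset Y)" for A
  proof -
    have "supercompact_open Y (topspace Y \<inter> \<Inter>A)"
      using sc_space_supercompact_Inter[OF Y A(1)] A(2) by auto
    then have "?h (\<Sqinter>\<^bsub>supercompact_poset Y\<^esub>A) = f -` (topspace Y \<inter> \<Inter>A) \<inter> topspace X"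
      using Inf_supercompact_poset[OF Y A] by (simp add: I_tilde_simps)
    also have "\<dots> = topspace X \<inter> (\<Inter>U\<in>A. f -` U \<inter> topspace X)"
      using sc_map_PiE[OF f] by auto
    also have "\<dots> = topspace X \<inter> \<Inter>(?h ` A)"
      using A(2) by (intro arg_cong2[where f = "(\<inter>)"] arg_cong[where f = Inter] image_cong refl)
        (auto simp: I_tilde_simps)
    also have "\<dots> = \<Sqinter>\<^bsub>supercompact_poset X\<^esub>(?h ` A)"
      by (rule Inf_supercompact_poset[OF X, symmetric]) (use A pre in \<open>auto simp: I_tilde_simps\<close>)
    finally show ?thesis .
  qed
  then show ?thesis
    using pre by (auto simp: mslat_hom_def I_tilde_simps)
qed

lemma is_functor_I_tilde:
  fixes S :: "'a set set"
  assumes S: "\<And>X :: 'a topology. sc_space X \<Longrightarrow> topspace X \<in> S \<Longrightarrow> {U. supercompact_open X U} \<in> S'"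
  shows "is_functor (SCTop S) (opposite (MSLat S')) I_tilde"
  unfolding is_functor_def
proof (intro conjI ballI)
  show "is_category (SCTop S)"
    by (rule is_category_concrete[OF concrete_category_SCTop])
  show "is_category (opposite (MSLat S'))"
    by (rule is_category_opposite[OF is_category_concrete[OF concrete_category_MSLat]])
next
  fix X :: "'a topology" assume X: "X \<in> Obj (SCTop S)"
  then show "on_obj I_tilde X \<in> Obj (opposite (MSLat S'))"
    using meet_semilattice_supercompact_poset[of X] S[of X]
    by (simp add: SCTop_def MSLat_def opposite_def I_tilde_simps)
  have "(\<lambda>x\<in>topspace X. x) -` U \<inter> topspace X = U" if "supercompact_open X U" for U
    using supercompact_open_subset[OF that] by auto
  then show "on_hom I_tilde X X (Id (SCTop S) X) = Id (opposite (MSLat S')) (on_obj I_tilde X)"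
    by (simp add: SCTop_def MSLat_def opposite_def I_tilde_simps cong: restrict_cong)
next
  fix X Y :: "'a topology" and f
  assume "X \<in> Obj (SCTop S)" "Y \<in> Obj (SCTop S)" "f \<in> Hom (SCTop S) X Y"
  then show "on_hom I_tilde X Y f \<in> Hom (opposite (MSLat S')) (on_obj I_tilde X) (on_obj I_tilde Y)"
    using I_tilde_hom[of X Y f] by (simp add: SCTop_def MSLat_def opposite_def I_tilde_simps(1))
next
  fix X Y Z :: "'a topology" and f g
  assume "X \<in> Obj (SCTop S)" "Y \<in> Obj (SCTop S)" "Z \<in> Obj (SCTop S)"
    and "f \<in> Hom (SCTop S) X Y" "g \<in> Hom (SCTop S) Y Z"
  then have f: "f \<in> sc_map X Y" and g: "g \<in> sc_map Y Z"
    by (simp_all add: SCTop_def)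
  have "on_hom I_tilde X Z (compose (topspace X) g f) =
      compose {U. supercompact_open Z U} (on_hom I_tilde X Y f) (on_hom I_tilde Y Z g)"
  proof (rule extensionalityI[of _ "{U. supercompact_open Z U}"])
    fix U assume U: "U \<in> {U. supercompact_open Z U}"
    then have "supercompact_open Y (g -` U \<inter> topspace Y)"
      using g by (simp add: sc_map_def)
    then show "on_hom I_tilde X Z (compose (topspace X) g f) U =
        compose {U. supercompact_open Z U} (on_hom I_tilde X Y f) (on_hom I_tilde Y Z g) U"
      using U sc_map_PiE[OF f] by (auto simp: I_tilde_simps compose_eq)
  qed (simp_all add: I_tilde_simps)
  then show "on_hom I_tilde X Z (Comp (SCTop S) X Y Z g f) =
      Comp (opposite (MSLat S')) (on_obj I_tilde X) (on_obj I_tilde Y) (on_obj I_tilde Z)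
        (on_hom I_tilde Y Z g) (on_hom I_tilde X Y f)"
    by (simp add: SCTop_def MSLat_def opposite_def I_tilde_simps(1))
qed

lemma poset_iso_supercompact_poset:
  assumes h: "homeomorphic_map X Y h"
  shows "poset_iso (supercompact_poset X) (supercompact_poset Y) ((`) h)"
proof -
  let ?g = "inv_into (topspace X) h"
  have g: "homeomorphic_map Y X ?g"
    by (rule homeomorphic_map_inverse[OF h])
  have "bij_betw ((`) h) {U. supercompact_open X U} {V. supercompact_open Y V}"
  proof (rule bij_betw_byWitness[where f' = "(`) ?g"])
    show "\<forall>U\<in>{U. supercompact_open X U}. ?g ` h ` U = U"
      by (simp add: homeomorphic_map_image_inverse(2)[OF h] supercompact_open_subset)
    show "\<forall>V\<in>{V. supercompact_open Y V}. h ` ?g ` V = V"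
      by (simp add: homeomorphic_map_image_inverse(1)[OF h] supercompact_open_subset)
  qed (use supercompact_open_homeomorphic_image[OF h] supercompact_open_homeomorphic_image[OF g] in auto)
  moreover have "h ` U \<subseteq> h ` V \<longleftrightarrow> U \<subseteq> V" if "supercompact_open X U" "supercompact_open X V" for U V
    using that by (metis image_mono homeomorphic_map_image_inverse(2)[OF h] supercompact_open_subset)
  ultimately show ?thesis
    by (simp add: poset_iso_def)
qed


section \<open>The space of filters\<close>

text \<open>The basic open set attached to an element; under the duality, the element itself.\<close>

definition filters_containing :: "'a gorder \<Rightarrow> 'a \<Rightarrow> 'a set set" where
  "filters_containing M x = {F \<in> filters M. x \<in> F}"

lemma filters_subset: "F \<in> filters M \<Longrightarrow> F \<subseteq> carrier M"
  by (simp add: filters_def upper_set_def)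

lemma filters_upward:
  "F \<in> filters M \<Longrightarrow> x \<in> F \<Longrightarrow> y \<in> carrier M \<Longrightarrow> x \<sqsubseteq>\<^bsub>M\<^esub> y \<Longrightarrow> y \<in> F"
  by (auto simp: filters_def upper_set_def)

lemma filters_top: "F \<in> filters M \<Longrightarrow> \<top>\<^bsub>M\<^esub> \<in> F"
  by (simp add: filters_def)

lemma filters_meet: "F \<in> filters M \<Longrightarrow> x \<in> F \<Longrightarrow> y \<in> F \<Longrightarrow> x \<sqinter>\<^bsub>M\<^esub> y \<in> F"
  by (simp add: filters_def)

lemma filtersI:
  assumes "F \<subseteq> carrier M" "\<top>\<^bsub>M\<^esub> \<in> F"
    and "\<And>x y. x \<in> F \<Longrightarrow> y \<in> carrier M \<Longrightarrow> x \<sqsubseteq>\<^bsub>M\<^esub> y \<Longrightarrow> y \<in> F"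
    and "\<And>x y. x \<in> F \<Longrightarrow> y \<in> F \<Longrightarrow> x \<sqinter>\<^bsub>M\<^esub> y \<in> F"
  shows "F \<in> filters M"
  using assms by (auto simp: filters_def upper_set_def)

lemma filters_vimage:
  assumes M: "meet_semilattice M" and N: "meet_semilattice N" and f: "f \<in> mslat_hom M N"
    and F: "F \<in> filters N"
  shows "f -` F \<inter> carrier M \<in> filters M"
proof (rule filtersI)
  show "\<top>\<^bsub>M\<^esub> \<in> f -` F \<inter> carrier M"
    using mslat_hom_top[OF f] filters_top[OF F] top_carrier[OF M] by simp
next
  fix x y assume "x \<in> f -` F \<inter> carrier M" "y \<in> carrier M" "x \<sqsubseteq>\<^bsub>M\<^esub> y"
  then show "y \<in> f -` F \<inter> carrier M"
    using mslat_hom_mono[OF M N f, of x y] filters_upward[OF F, of "f x" "f y"] mslat_hom_PiE[OF f]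
    by auto
next
  fix x y assume "x \<in> f -` F \<inter> carrier M" "y \<in> f -` F \<inter> carrier M"
  then show "x \<sqinter>\<^bsub>M\<^esub> y \<in> f -` F \<inter> carrier M"
    using mslat_hom_meet[OF f, of x y] filters_meet[OF F, of "f x" "f y"] meet_carrier[OF M] by simp
qed auto

context
  fixes M :: "'a gorder"
  assumes M: "meet_semilattice M"
begin

lemma principal_filter:
  assumes "x \<in> carrier M"
  shows "{y \<in> carrier M. x \<sqsubseteq>\<^bsub>M\<^esub> y} \<in> filters M"
  by (rule filtersI)
    (use assms M in \<open>auto simp: le_top top_carrier meet_carrier le_meet_iff
      intro: meet_semilattice_trans[of M x]\<close>)

lemma filters_containing_subset_iff:
  assumes "x \<in> carrier M" "y \<in> carrier M"
  shows "filters_containing M x \<subseteq> filters_containing M y \<longleftrightarrow> x \<sqsubseteq>\<^bsub>M\<^esub> y"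
proof
  assume "filters_containing M x \<subseteq> filters_containing M y"
  then have "{y \<in> carrier M. x \<sqsubseteq>\<^bsub>M\<^esub> y} \<in> filters_containing M y"
    using principal_filter[OF assms(1)] meet_semilattice_refl[OF M assms(1)] assms(1)
    by (auto simp: filters_containing_def)
  then show "x \<sqsubseteq>\<^bsub>M\<^esub> y"
    by (simp add: filters_containing_def)
next
  assume "x \<sqsubseteq>\<^bsub>M\<^esub> y"
  then show "filters_containing M x \<subseteq> filters_containing M y"
    using filters_upward assms(2) by (auto simp: filters_containing_def)
qed

lemma filters_containing_top: "filters_containing M \<top>\<^bsub>M\<^esub> = filters M"
  using filters_top by (auto simp: filters_containing_def)

lemma filters_containing_meet:
  assumes "x \<in> carrier M" "y \<in> carrier M"
  shows "filters_containing M (x \<sqinter>\<^bsub>M\<^esub> y) = filters_containing M x \<inter> filters_containing M y"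
proof
  have "x \<sqinter>\<^bsub>M\<^esub> y \<sqsubseteq>\<^bsub>M\<^esub> x" "x \<sqinter>\<^bsub>M\<^esub> y \<sqsubseteq>\<^bsub>M\<^esub> y"
    using le_meet_iff[OF M assms meet_carrier[OF M assms]]
      meet_semilattice_refl[OF M meet_carrier[OF M assms]] by simp_all
  then show "filters_containing M (x \<sqinter>\<^bsub>M\<^esub> y) \<subseteq> filters_containing M x \<inter> filters_containing M y"
    using filters_containing_subset_iff meet_carrier[OF M assms] assms by simp
  show "filters_containing M x \<inter> filters_containing M y \<subseteq> filters_containing M (x \<sqinter>\<^bsub>M\<^esub> y)"
    using filters_meet by (auto simp: filters_containing_def)
qed

lemma openin_filters_containing:
  assumes "x \<in> carrier M"
  shows "openin (filter_space M) (filters_containing M x)"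
  unfolding openin_filter_space[OF M]
proof (intro exI conjI)
  show "lower_set M {y \<in> carrier M. y \<sqsubseteq>\<^bsub>M\<^esub> x}"
    using meet_semilattice_trans[OF M _ _ assms] by (auto simp: lower_set_def)
  show "filters_containing M x = {F \<in> filters M. F \<inter> {y \<in> carrier M. y \<sqsubseteq>\<^bsub>M\<^esub> x} \<noteq> {}}"
    using assms filters_upward meet_semilattice_refl[OF M assms]
    by (auto simp: filters_containing_def)
qed

lemma openin_filter_space_basis:
  assumes "openin (filter_space M) V" "F \<in> V"
  shows "\<exists>x\<in>F. filters_containing M x \<subseteq> V"
  using assms unfolding openin_filter_space[OF M] by (auto simp: filters_containing_def)

text \<open>The principal filter of \<open>x\<close> is the least point of the basic open set of \<open>x\<close>: an open set
  that contains it contains all of the basic open set. This makes the basic open sets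
  supercompact, and there are no others because they form a basis.\<close>

lemma supercompact_open_filter_space_iff:
  "supercompact_open (filter_space M) V \<longleftrightarrow> V \<in> filters_containing M ` carrier M"
proof
  assume V: "supercompact_open (filter_space M) V"
  let ?\<U> = "filters_containing M ` {x \<in> carrier M. filters_containing M x \<subseteq> V}"
  have "V \<subseteq> \<Union>?\<U>"
  proof
    fix F assume F: "F \<in> V"
    then have F': "F \<in> filters M"
      using supercompact_open_subset[OF V] by (auto simp: topspace_filter_space[OF M])
    obtain x where x: "x \<in> F" "filters_containing M x \<subseteq> V"
      using openin_filter_space_basis[OF supercompact_open_openin[OF V] F] by blast
    then have "x \<in> carrier M" "F \<in> filters_containing M x"
      using F' filters_subset[OF F'] by (auto simp: filters_containing_def)
    then show "F \<in> \<Union>?\<U>"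
      using x(2) by blast
  qed
  then have "\<exists>U\<in>?\<U>. V \<subseteq> U"
    by (intro supercompact_open_cover[OF V]) (auto intro: openin_filters_containing)
  then show "V \<in> filters_containing M ` carrier M"
    by blast
next
  assume "V \<in> filters_containing M ` carrier M"
  then obtain x where x: "x \<in> carrier M" "V = filters_containing M x"
    by blast
  let ?F = "{y \<in> carrier M. x \<sqsubseteq>\<^bsub>M\<^esub> y}"
  have "?F \<in> V"
    using x principal_filter[OF x(1)] meet_semilattice_refl[OF M x(1)]
    by (simp add: filters_containing_def)
  have "V \<in> \<U>" if \<U>: "\<forall>U\<in>\<U>. openin (filter_space M) U" "V = \<Union>\<U>" for \<U>
  proof -
    obtain U where U: "U \<in> \<U>" "?F \<in> U"
      using \<U>(2) \<open>?F \<in> V\<close> by blast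
    then obtain y where y: "y \<in> ?F" "filters_containing M y \<subseteq> U"
      using openin_filter_space_basis \<U>(1) by blast
    then have "V \<subseteq> U"
      using filters_containing_subset_iff[OF x(1), of y] x(2) by auto
    then have "V = U"
      using U(1) \<U>(2) by blast
    then show ?thesis
      using U(1) by simp
  qed
  then show "supercompact_open (filter_space M) V"
    using openin_filters_containing x by (simp add: supercompact_open_def)
qed

lemma closure_of_filter:
  assumes F: "F \<in> filters M"
  shows "filter_space M closure_of {F} = {G \<in> filters M. G \<subseteq> F}"
proof (intro equalityI subsetI)
  fix G assume G: "G \<in> filter_space M closure_of {F}"
  have "x \<in> F" if "x \<in> G" "G \<in> filters M" for x
  proof -
    have "openin (filter_space M) (filters_containing M x)" "G \<in> filters_containing M x"
      using that filters_subset openin_filters_containing by (auto simp: filters_containing_def)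
    then have "F \<in> filters_containing M x"
      using G by (auto simp: in_closure_of)
    then show ?thesis
      by (simp add: filters_containing_def)
  qed
  then show "G \<in> {G \<in> filters M. G \<subseteq> F}"
    using G by (auto simp: in_closure_of topspace_filter_space[OF M])
next
  fix G assume G: "G \<in> {G \<in> filters M. G \<subseteq> F}"
  have "F \<in> V" if V: "openin (filter_space M) V" "G \<in> V" for V
  proof -
    obtain x where "x \<in> G" "filters_containing M x \<subseteq> V"
      using openin_filter_space_basis[OF V] by blast
    then show ?thesis
      using F G by (auto simp: filters_containing_def)
  qed
  then show "G \<in> filter_space M closure_of {F}"
    using G by (auto simp: in_closure_of topspace_filter_space[OF M])
qed

text \<open>The generic point of an irreducible closed set \<open>C\<close> is the set of those elements whose basic
  open set meets \<open>C\<close>, which is the union of \<open>C\<close>. Irreducibility is what makes it closed under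
  binary meets, and non-emptiness puts the top element into it.\<close>

lemma sober_filter_space: "sober_space (filter_space M)"
  unfolding sober_space_def
proof (intro allI impI)
  fix C assume C: "irreducible_closed (filter_space M) C"
  then have closed: "closedin (filter_space M) C" and "C \<noteq> {}"
    by (auto simp: irreducible_closed_def)
  have sub: "C \<subseteq> filters M"
    using closedin_subset[OF closed] by (simp add: topspace_filter_space[OF M])
  have meets: "filters_containing M x \<inter> C \<noteq> {} \<longleftrightarrow> x \<in> \<Union>C" for x
    using sub by (auto simp: filters_containing_def)
  have carrier: "\<Union>C \<subseteq> carrier M"
    using sub filters_subset[of _ M] by blast
  have filter: "\<Union>C \<in> filters M"
  proof (rule filtersI[OF carrier])
    show "\<top>\<^bsub>M\<^esub> \<in> \<Union>C"
      using sub \<open>C \<noteq> {}\<close> filters_top[of _ M] by blast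
    show "y \<in> \<Union>C" if xy: "x \<in> \<Union>C" "y \<in> carrier M" "x \<sqsubseteq>\<^bsub>M\<^esub> y" for x y
    proof -
      obtain G where "G \<in> C" "x \<in> G"
        using xy(1) by blast
      then have "y \<in> G"
        using filters_upward[of G M x y] sub xy(2,3) by blast
      then show ?thesis
        using \<open>G \<in> C\<close> by blast
    qed
    show "x \<sqinter>\<^bsub>M\<^esub> y \<in> \<Union>C" if "x \<in> \<Union>C" "y \<in> \<Union>C" for x y
    proof -
      have xy: "x \<in> carrier M" "y \<in> carrier M"
        using that carrier by auto
      have "filters_containing M x \<inter> filters_containing M y \<inter> C \<noteq> {}"
        by (rule irreducible_closed_Int[OF C])
          (use that xy meets openin_filters_containing in auto)
      then show ?thesis
        using meets filters_containing_meet[OF xy] by metis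
    qed
  qed
  have "G \<in> C" if G: "G \<in> filters M" "G \<subseteq> \<Union>C" for G
  proof (rule ccontr)
    assume "G \<notin> C"
    moreover have "openin (filter_space M) (filters M - C)"
      using closed by (simp add: closedin_def topspace_filter_space[OF M])
    ultimately obtain x where x: "x \<in> G" "filters_containing M x \<subseteq> filters M - C"
      using openin_filter_space_basis[of "filters M - C" G] G(1) by auto
    then show False
      using meets[of x] G(2) by blast
  qed
  then have closure: "filter_space M closure_of {\<Union>C} = C"
    using closure_of_filter[OF filter] sub by auto
  show "\<exists>!F. F \<in> topspace (filter_space M) \<and> filter_space M closure_of {F} = C"
  proof (rule ex1I[of _ "\<Union>C"])
    show "\<Union>C \<in> topspace (filter_space M) \<and> filter_space M closure_of {\<Union>C} = C"
      using filter closure by (simp add: topspace_filter_space[OF M])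
    fix F assume "F \<in> topspace (filter_space M) \<and> filter_space M closure_of {F} = C"
    then have "C = {G \<in> filters M. G \<subseteq> F}" "F \<in> filters M"
      using closure_of_filter[of F] by (auto simp: topspace_filter_space[OF M])
    then show "F = \<Union>C"
      by blast
  qed
qed

lemma sc_space_filter_space: "sc_space (filter_space M)"
  unfolding sc_space_iff supercompact_open_filter_space_iff
proof (intro conjI allI impI sober_filter_space)
  show "topspace (filter_space M) \<in> filters_containing M ` carrier M"
    using filters_containing_top top_carrier[OF M] topspace_filter_space[OF M] by (metis imageI)
next
  fix U V
  assume "U \<in> filters_containing M ` carrier M \<and> V \<in> filters_containing M ` carrier M"
  then obtain x y where "x \<in> carrier M" "y \<in> carrier M"
    and "U = filters_containing M x" "V = filters_containing M y"
    by blast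
  then show "U \<inter> V \<in> filters_containing M ` carrier M"
    using filters_containing_meet meet_carrier[OF M] by (metis imageI)
next
  fix U F assume U: "openin (filter_space M) U \<and> F \<in> U"
  then have F: "F \<in> filters M"
    using openin_subset topspace_filter_space[OF M] by blast
  obtain x where "x \<in> F" "filters_containing M x \<subseteq> U"
    using U openin_filter_space_basis by blast
  then show "\<exists>V. V \<in> filters_containing M ` carrier M \<and> F \<in> V \<and> V \<subseteq> U"
    using F filters_subset[OF F] by (intro exI[of _ "filters_containing M x"])
      (auto simp: filters_containing_def)
qed

text \<open>The unit of the duality.\<close>

lemma poset_iso_filters_containing:
  "poset_iso M (supercompact_poset (filter_space M)) (filters_containing M)"
proof -
  have "inj_on (filters_containing M) (carrier M)"
    using filters_containing_subset_iff meet_semilattice_antisym[OF M]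
    by (metis inj_onI order_refl)
  then show ?thesis
    using filters_containing_subset_iff supercompact_open_filter_space_iff
    by (auto simp: poset_iso_def bij_betw_def)
qed

end

text \<open>This equation says that the unit is natural. It also shows that preimages of basic open sets
  are basic, which makes the action of a homomorphism on filters an arrow of spaces.\<close>

lemma vimage_filters_containing:
  assumes M: "meet_semilattice M" and N: "meet_semilattice N" and f: "f \<in> mslat_hom M N"
    and x: "x \<in> carrier M"
  shows "(\<lambda>F\<in>filters N. f -` F \<inter> carrier M) -` filters_containing M x \<inter> filters N =
    filters_containing N (f x)"
  using filters_vimage[OF M N f] x by (auto simp: filters_containing_def)

lemma filters_vimage_sc_map:
  assumes M: "meet_semilattice M" and N: "meet_semilattice N" and f: "f \<in> mslat_hom M N"
  shows "(\<lambda>F\<in>filters N. f -` F \<inter> carrier M) \<in> sc_map (filter_space N) (filter_space M)"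
proof -
  let ?a = "\<lambda>F\<in>filters N. f -` F \<inter> carrier M"
  have fN: "f x \<in> carrier N" if "x \<in> carrier M" for x
    using mslat_hom_PiE[OF f] that by auto
  have a: "?a F \<in> filters M" if "F \<in> filters N" for F
    using filters_vimage[OF M N f that] that by simp
  have "openin (filter_space N) {F \<in> filters N. ?a F \<in> V}" if V: "openin (filter_space M) V" for V
  proof -
    let ?B = "{x \<in> carrier M. filters_containing M x \<subseteq> V}"
    have "{F \<in> filters N. ?a F \<in> V} = (\<Union>x\<in>?B. filters_containing N (f x))"
    proof (intro equalityI subsetI)
      fix F assume F: "F \<in> {F \<in> filters N. ?a F \<in> V}"
      then obtain x where x: "x \<in> ?a F" "filters_containing M x \<subseteq> V"
        using openin_filter_space_basis[OF M V, of "?a F"] by auto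
      then have "x \<in> ?B" "F \<in> filters_containing N (f x)"
        using F by (auto simp: filters_containing_def)
      then show "F \<in> (\<Union>x\<in>?B. filters_containing N (f x))"
        by blast
    next
      fix F assume "F \<in> (\<Union>x\<in>?B. filters_containing N (f x))"
      then obtain x where "x \<in> ?B" "F \<in> filters_containing N (f x)"
        by blast
      then show "F \<in> {F \<in> filters N. ?a F \<in> V}"
        using vimage_filters_containing[OF M N f, of x] by auto
    qed
    then show ?thesis
      using fN openin_filters_containing[OF N] by (auto intro!: openin_Union)
  qed
  then have "continuous_map (filter_space N) (filter_space M) ?a"
    using a by (simp add: continuous_map_def topspace_filter_space[OF M] topspace_filter_space[OF N])
  moreover have "supercompact_open (filter_space N) (?a -` U \<inter> topspace (filter_space N))"
    if "supercompact_open (filter_space M) U" for U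
    using that vimage_filters_containing[OF M N f] fN
    by (auto simp: supercompact_open_filter_space_iff[OF M] supercompact_open_filter_space_iff[OF N]
        topspace_filter_space[OF N])
  ultimately show ?thesis
    by (simp add: sc_map_def topspace_filter_space[OF N])
qed

lemma A_tilde_simps:
  "on_obj A_tilde M = filter_space M"
  "on_hom A_tilde N M f = (\<lambda>F\<in>filters N. f -` F \<inter> carrier M)"
  by (simp_all add: A_tilde_def)

lemma is_functor_A_tilde:
  fixes S :: "'a set set"
  assumes S: "\<And>M :: 'a gorder. meet_semilattice M \<Longrightarrow> carrier M \<in> S \<Longrightarrow> filters M \<in> S'"
  shows "is_functor (opposite (MSLat S)) (SCTop S') A_tilde"
  unfolding is_functor_def
proof (intro conjI ballI)
  show "is_category (SCTop S')"
    by (rule is_category_concrete[OF concrete_category_SCTop])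
  show "is_category (opposite (MSLat S))"
    by (rule is_category_opposite[OF is_category_concrete[OF concrete_category_MSLat]])
next
  fix M :: "'a gorder" assume "M \<in> Obj (opposite (MSLat S))"
  then have M: "meet_semilattice M" "carrier M \<in> S"
    by (simp_all add: MSLat_def opposite_def)
  then show "on_obj A_tilde M \<in> Obj (SCTop S')"
    using sc_space_filter_space S
    by (simp add: SCTop_def A_tilde_simps topspace_filter_space)
  have "(\<lambda>x\<in>carrier M. x) -` F \<inter> carrier M = F" if "F \<in> filters M" for F
    using filters_subset[OF that] by auto
  then show "on_hom A_tilde M M (Id (opposite (MSLat S)) M) = Id (SCTop S') (on_obj A_tilde M)"
    by (simp add: SCTop_def MSLat_def opposite_def A_tilde_simps topspace_filter_space[OF M(1)]
        cong: restrict_cong)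
next
  fix N M :: "'a gorder" and f
  assume "N \<in> Obj (opposite (MSLat S))" "M \<in> Obj (opposite (MSLat S))"
    "f \<in> Hom (opposite (MSLat S)) N M"
  then show "on_hom A_tilde N M f \<in> Hom (SCTop S') (on_obj A_tilde N) (on_obj A_tilde M)"
    using filters_vimage_sc_map[of M N f]
    by (simp add: SCTop_def MSLat_def opposite_def A_tilde_simps)
next
  fix P N M :: "'a gorder" and f g
  assume "P \<in> Obj (opposite (MSLat S))" "N \<in> Obj (opposite (MSLat S))"
    "M \<in> Obj (opposite (MSLat S))" "f \<in> Hom (opposite (MSLat S)) P N"
    "g \<in> Hom (opposite (MSLat S)) N M"
  then have P: "meet_semilattice P" and N: "meet_semilattice N" and M: "meet_semilattice M"
    and f: "f \<in> mslat_hom N P" and g: "g \<in> mslat_hom M N"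
    by (simp_all add: MSLat_def opposite_def)
  have "on_hom A_tilde P M (compose (carrier M) f g) =
      compose (filters P) (on_hom A_tilde N M g) (on_hom A_tilde P N f)"
  proof (rule extensionalityI[of _ "filters P"])
    fix F assume F: "F \<in> filters P"
    then show "on_hom A_tilde P M (compose (carrier M) f g) F =
        compose (filters P) (on_hom A_tilde N M g) (on_hom A_tilde P N f) F"
      using filters_vimage[OF N P f F] mslat_hom_PiE[OF g]
      by (auto simp: A_tilde_simps compose_eq)
  qed (simp_all add: A_tilde_simps)
  then show "on_hom A_tilde P M (Comp (opposite (MSLat S)) P N M g f) =
      Comp (SCTop S') (on_obj A_tilde P) (on_obj A_tilde N) (on_obj A_tilde M)
        (on_hom A_tilde N M g) (on_hom A_tilde P N f)"
    by (simp add: SCTop_def MSLat_def opposite_def A_tilde_simps(1) topspace_filter_space[OF P])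
qed

text \<open>The image of a filter under \<open>\<phi>\<close> is its preimage under the inverse of \<open>\<phi>\<close>, so continuity in both
  directions is an instance of the action of homomorphisms on filters.\<close>

lemma homeomorphic_map_filter_space:
  assumes M: "meet_semilattice M" and N: "meet_semilattice N" and \<phi>: "poset_iso M N \<phi>"
  shows "homeomorphic_map (filter_space M) (filter_space N) ((`) \<phi>)"
proof -
  let ?\<psi> = "inv_into (carrier M) \<phi>"
  have \<psi>: "poset_iso N M ?\<psi>"
    by (rule poset_iso_inverse[OF \<phi>])
  have bij: "bij_betw \<phi> (carrier M) (carrier N)"
    using \<phi> by (simp add: poset_iso_def)
  let ?a = "\<lambda>F\<in>filters M. restrict ?\<psi> (carrier N) -` F \<inter> carrier N"
  let ?b = "\<lambda>G\<in>filters N. restrict \<phi> (carrier M) -` G \<inter> carrier M"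
  have a: "?a \<in> sc_map (filter_space M) (filter_space N)"
    by (rule filters_vimage_sc_map[OF N M poset_iso_mslat_hom[OF N M \<psi>]])
  have b: "?b \<in> sc_map (filter_space N) (filter_space M)"
    by (rule filters_vimage_sc_map[OF M N poset_iso_mslat_hom[OF M N \<phi>]])
  have a_eq: "?a F = \<phi> ` F" if F: "F \<in> filters M" for F
  proof -
    have "?a F = ?\<psi> -` F \<inter> carrier N"
      using F by auto
    also have "\<dots> = \<phi> ` F"
      using filters_subset[OF F] bij_betw_inv_into_left[OF bij] bij_betw_inv_into_right[OF bij]
        bij_betwE[OF bij] by (auto simp: image_iff subset_iff) metis
    finally show ?thesis .
  qed
  have b_eq: "?b G = \<phi> -` G \<inter> carrier M" if "G \<in> filters N" for G
    using that by auto
  have "homeomorphic_maps (filter_space M) (filter_space N) ?a ?b"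
    unfolding homeomorphic_maps_def topspace_filter_space[OF M] topspace_filter_space[OF N]
  proof (intro conjI ballI)
    show "continuous_map (filter_space M) (filter_space N) ?a"
      "continuous_map (filter_space N) (filter_space M) ?b"
      using a b by (simp_all add: sc_map_def)
  next
    fix F assume F: "F \<in> filters M"
    have "?a F \<in> filters N"
      using sc_map_PiE[OF a] F by (auto simp: topspace_filter_space[OF M] topspace_filter_space[OF N])
    then have "?b (?a F) = \<phi> -` \<phi> ` F \<inter> carrier M"
      using a_eq[OF F] b_eq by simp
    also have "\<dots> = F"
      using filters_subset[OF F] bij by (auto simp: bij_betw_def inj_on_def)
    finally show "?b (?a F) = F" .
  next
    fix G assume G: "G \<in> filters N"
    have "?b G \<in> filters M"
      using sc_map_PiE[OF b] G by (auto simp: topspace_filter_space[OF M] topspace_filter_space[OF N])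
    then have "?a (?b G) = \<phi> ` (\<phi> -` G \<inter> carrier M)"
      unfolding b_eq[OF G] by (rule a_eq)
    also have "\<dots> = G"
    proof -
      have "G \<subseteq> \<phi> ` carrier M"
        using filters_subset[OF G] bij by (simp add: bij_betw_def)
      then show ?thesis
        by blast
    qed
    finally show "?a (?b G) = G" .
  qed
  then have "homeomorphic_map (filter_space M) (filter_space N) ?a"
    by (rule homeomorphic_maps_imp_map)
  then show ?thesis
    by (rule homeomorphic_map_eq) (rule a_eq, simp add: topspace_filter_space[OF M])
qed

section \<open>Recovering a space from its supercompact opens\<close>

definition supercompact_nhds :: "'a topology \<Rightarrow> 'a \<Rightarrow> 'a set set" where
  "supercompact_nhds X p = {U. supercompact_open X U \<and> p \<in> U}"

lemma supercompact_nhds_filter: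
  assumes X: "sc_space X" and p: "p \<in> topspace X"
  shows "supercompact_nhds X p \<in> filters (supercompact_poset X)"
proof (rule filtersI)
  show "\<top>\<^bsub>supercompact_poset X\<^esub> \<in> supercompact_nhds X p"
    using X p by (simp add: top_supercompact_poset supercompact_nhds_def sc_space_iff)
next
  fix U V assume "U \<in> supercompact_nhds X p" "V \<in> supercompact_nhds X p"
  then show "U \<sqinter>\<^bsub>supercompact_poset X\<^esub> V \<in> supercompact_nhds X p"
    using X by (simp add: meet_supercompact_poset supercompact_nhds_def) (simp add: sc_space_iff)
qed (auto simp: supercompact_nhds_def)

text \<open>The supercompact neighbourhoods of a point determine its closure, and therefore the point.\<close>

lemma inj_on_supercompact_nhds:
  assumes X: "sc_space X"
  shows "inj_on (supercompact_nhds X) (topspace X)"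
proof (rule inj_onI)
  fix p q assume p: "p \<in> topspace X" and q: "q \<in> topspace X"
    and eq: "supercompact_nhds X p = supercompact_nhds X q"
  have iff: "p \<in> U \<longleftrightarrow> q \<in> U" if U: "openin X U" for U
  proof -
    have "x \<in> U \<longleftrightarrow> (\<exists>V\<in>supercompact_nhds X x. V \<subseteq> U)" for x
      using X U unfolding sc_space_iff supercompact_nhds_def by blast
    then show ?thesis
      using eq by simp
  qed
  then have "X closure_of {p} = X closure_of {q}"
    by (auto simp: in_closure_of)
  then show "p = q"
    using sober_space_closure_inj[OF _ p q] X by (simp add: sc_space_iff)
qed

text \<open>Conversely every filter \<open>F\<close> is the neighbourhood filter of a point, namely of the generic
  point of the complement \<open>C\<close> of the union of all supercompact opens outside \<open>F\<close>. A
  supercompact open in \<open>F\<close> cannot be covered by those outside \<open>F\<close>, being contained in one of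
  them otherwise; so the supercompact opens that meet \<open>C\<close> are exactly those in \<open>F\<close>, and
  closure of \<open>F\<close> under intersections becomes irreducibility of \<open>C\<close>.\<close>

lemma supercompact_nhds_surj:
  assumes X: "sc_space X" and F: "F \<in> filters (supercompact_poset X)"
  shows "\<exists>p\<in>topspace X. supercompact_nhds X p = F"
proof -
  let ?\<V> = "{V. supercompact_open X V \<and> V \<notin> F}"
  define C where "C = topspace X - \<Union>?\<V>"
  have sc: "supercompact_open X U" if "U \<in> F" for U
    using filters_subset[OF F] that by auto
  have meets: "U \<inter> C \<noteq> {} \<longleftrightarrow> U \<in> F" if U: "supercompact_open X U" for U
  proof
    assume "U \<in> F"
    show "U \<inter> C \<noteq> {}"
    proof
      assume "U \<inter> C = {}"
      then have "U \<subseteq> \<Union>?\<V>"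
        using supercompact_open_subset[OF U] by (auto simp: C_def)
      then have "\<exists>V\<in>?\<V>. U \<subseteq> V"
        by (intro supercompact_open_cover[OF U]) (auto intro: supercompact_open_openin)
      then show False
        using filters_upward[OF F \<open>U \<in> F\<close>] by auto
    qed
  qed (use U in \<open>auto simp: C_def\<close>)
  have "openin X (\<Union>?\<V>)"
    by (auto intro: supercompact_open_openin)
  then have closed: "closedin X C"
    by (simp add: C_def closedin_diff)
  have "irreducible_closed X C"
  proof (rule irreducible_closedI[OF closed, where P = "supercompact_open X"])
    have "topspace X \<in> F"
      using filters_top[OF F] by (simp add: top_supercompact_poset[OF X])
    then show "C \<noteq> {}"
      using meets[OF sc] by blast
    show "\<exists>V. supercompact_open X V \<and> x \<in> V \<and> V \<subseteq> U" if "openin X U" "x \<in> U" for U x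
      using X that by (simp add: sc_space_iff)
    show "U \<inter> V \<inter> C \<noteq> {}"
      if U: "supercompact_open X U" "U \<inter> C \<noteq> {}" and V: "supercompact_open X V" "V \<inter> C \<noteq> {}" for U V
    proof -
      have "U \<inter> V \<in> F"
        using filters_meet[OF F, of U V] meets[OF U(1)] meets[OF V(1)] U V
        by (simp add: meet_supercompact_poset[OF X])
      then show ?thesis
        using meets[OF sc] by blast
    qed
  qed
  then obtain p where p: "p \<in> topspace X" "X closure_of {p} = C"
    using X unfolding sc_space_iff sober_space_def by blast
  have "p \<in> U \<longleftrightarrow> U \<in> F" if U: "supercompact_open X U" for U
  proof -
    have "p \<in> U \<longleftrightarrow> U \<inter> C \<noteq> {}"
      unfolding p(2)[symmetric] using supercompact_open_openin[OF U] p(1) by (auto simp: in_closure_of)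
    then show ?thesis
      using meets[OF U] by simp
  qed
  then have "supercompact_nhds X p = F"
    using sc by (auto simp: supercompact_nhds_def)
  then show ?thesis
    using p(1) by blast
qed

text \<open>The counit of the duality. It matches a supercompact open \<open>U\<close> with the basic open set of the
  element \<open>U\<close>.\<close>

lemma homeomorphic_map_supercompact_nhds:
  assumes X: "sc_space X"
  shows "homeomorphic_map X (filter_space (supercompact_poset X)) (supercompact_nhds X)"
proof -
  let ?P = "supercompact_poset X" and ?v = "supercompact_nhds X"
  have P: "meet_semilattice ?P"
    by (rule meet_semilattice_supercompact_poset[OF X])
  have im: "?v ` topspace X = filters ?P"
    using supercompact_nhds_filter[OF X] supercompact_nhds_surj[OF X] by blast
  have v_image: "?v ` U = filters_containing ?P U" if U: "supercompact_open X U" for U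
    using supercompact_open_subset[OF U] U im[symmetric]
    by (auto simp: filters_containing_def supercompact_nhds_def)
  show ?thesis
  proof (rule bijective_open_imp_homeomorphic_map)
    show "?v ` topspace X = topspace (filter_space ?P)"
      using im by (simp add: topspace_filter_space[OF P])
    show "inj_on ?v (topspace X)"
      by (rule inj_on_supercompact_nhds[OF X])
    show "open_map X (filter_space ?P) ?v"
      unfolding open_map_def
    proof (intro allI impI)
      fix U assume U: "openin X U"
      have "U = \<Union>{V. supercompact_open X V \<and> V \<subseteq> U}"
        using X U unfolding sc_space_iff by blast
      then have "?v ` U = (\<Union>V\<in>{V. supercompact_open X V \<and> V \<subseteq> U}. ?v ` V)"
        by (metis image_Union)
      also have "openin (filter_space ?P) \<dots>"
        using openin_filters_containing[OF P] v_image by (intro openin_Union) auto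
      finally show "openin (filter_space ?P) (?v ` U)" .
    qed
    have "openin X {p \<in> topspace X. ?v p \<in> W}" if W: "openin (filter_space ?P) W" for W
    proof -
      let ?\<U> = "{U. supercompact_open X U \<and> filters_containing ?P U \<subseteq> W}"
      have "{p \<in> topspace X. ?v p \<in> W} = \<Union>?\<U>"
      proof (intro equalityI subsetI)
        fix p assume "p \<in> {p \<in> topspace X. ?v p \<in> W}"
        then obtain U where "U \<in> ?v p" "filters_containing ?P U \<subseteq> W"
          using openin_filter_space_basis[OF P W, of "?v p"] by auto
        then show "p \<in> \<Union>?\<U>"
          by (auto simp: supercompact_nhds_def)
      next
        fix p assume "p \<in> \<Union>?\<U>"
        then obtain U where U: "supercompact_open X U" "filters_containing ?P U \<subseteq> W" "p \<in> U"
          by blast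
        then show "p \<in> {p \<in> topspace X. ?v p \<in> W}"
          using v_image[OF U(1)] supercompact_open_subset[OF U(1)] by auto
      qed
      then show ?thesis
        by (auto intro: supercompact_open_openin)
    qed
    then show "continuous_map X (filter_space ?P) ?v"
      unfolding continuous_map_def using im by (auto simp: topspace_filter_space[OF P])
  qed
qed

lemma vimage_supercompact_nhds:
  assumes f: "f \<in> sc_map X Y" and p: "p \<in> topspace X"
  shows "(\<lambda>U\<in>{U. supercompact_open Y U}. f -` U \<inter> topspace X) -` supercompact_nhds X p \<inter>
    {U. supercompact_open Y U} = supercompact_nhds Y (f p)"
  using f p by (auto simp: supercompact_nhds_def sc_map_def)


section \<open>The duality\<close>

text \<open>Every order isomorphism between meet-semilattices is an arrow with an inverse arrow, and so is
  every homeomorphism between spaces. This leaves only naturality to be checked for families of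
  such maps.\<close>

lemma nat_isomorphic_MSLat:
  fixes F :: "('a gorder, 'a \<Rightarrow> 'a, 'b gorder, 'b \<Rightarrow> 'b) funct"
  assumes F: "is_functor (MSLat S) (MSLat S') F" and G: "is_functor (MSLat S) (MSLat S') G"
    and \<alpha>: "\<And>M. M \<in> Obj (MSLat S) \<Longrightarrow> poset_iso M (on_obj F M) (\<alpha> M)"
    and \<beta>: "\<And>M. M \<in> Obj (MSLat S) \<Longrightarrow> poset_iso M (on_obj G M) (\<beta> M)"
    and nat_\<alpha>: "\<And>M N f x. M \<in> Obj (MSLat S) \<Longrightarrow> N \<in> Obj (MSLat S) \<Longrightarrow> f \<in> mslat_hom M N \<Longrightarrow>
      x \<in> carrier M \<Longrightarrow> on_hom F M N f (\<alpha> M x) = \<alpha> N (f x)"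
    and nat_\<beta>: "\<And>M N f x. M \<in> Obj (MSLat S) \<Longrightarrow> N \<in> Obj (MSLat S) \<Longrightarrow> f \<in> mslat_hom M N \<Longrightarrow>
      x \<in> carrier M \<Longrightarrow> on_hom G M N f (\<beta> M x) = \<beta> N (f x)"
  shows "nat_isomorphic (MSLat S) (MSLat S') F G"
proof (rule nat_isomorphic_concrete[OF concrete_category_MSLat concrete_category_MSLat F G])
  fix M :: "'a gorder" assume M: "M \<in> Obj (MSLat S)"
  show "bij_betw (\<alpha> M) (carrier M) (carrier (on_obj F M))"
    "bij_betw (\<beta> M) (carrier M) (carrier (on_obj G M))"
    using \<alpha>[OF M] \<beta>[OF M] by (simp_all add: poset_iso_def)
  have FM: "meet_semilattice (on_obj F M)" and GM: "meet_semilattice (on_obj G M)"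
    using F G M by (simp_all add: is_functor_def MSLat_def)
  show "(\<lambda>y\<in>carrier (on_obj F M). \<beta> M (inv_into (carrier M) (\<alpha> M) y)) \<in>
      Hom (MSLat S') (on_obj F M) (on_obj G M)"
    using poset_iso_mslat_hom[OF FM GM poset_iso_comp[OF poset_iso_inverse[OF \<alpha>[OF M]] \<beta>[OF M]]]
    by (simp add: MSLat_def comp_def)
  show "(\<lambda>y\<in>carrier (on_obj G M). \<alpha> M (inv_into (carrier M) (\<beta> M) y)) \<in>
      Hom (MSLat S') (on_obj G M) (on_obj F M)"
    using poset_iso_mslat_hom[OF GM FM poset_iso_comp[OF poset_iso_inverse[OF \<beta>[OF M]] \<alpha>[OF M]]]
    by (simp add: MSLat_def comp_def)
next
  fix M N :: "'a gorder" and f x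
  assume M: "M \<in> Obj (MSLat S)" and N: "N \<in> Obj (MSLat S)"
    and "f \<in> Hom (MSLat S) M N" and x: "x \<in> carrier M"
  then have f: "f \<in> mslat_hom M N"
    by (simp add: MSLat_def)
  show "on_hom F M N f (\<alpha> M x) = \<alpha> N (f x)"
    by (rule nat_\<alpha>[OF M N f x])
  show "on_hom G M N f (\<beta> M x) = \<beta> N (f x)"
    by (rule nat_\<beta>[OF M N f x])
qed

lemma nat_isomorphic_SCTop:
  fixes F :: "('a topology, 'a \<Rightarrow> 'a, 'b topology, 'b \<Rightarrow> 'b) funct"
  assumes F: "is_functor (SCTop S) (SCTop S') F" and G: "is_functor (SCTop S) (SCTop S') G"
    and \<alpha>: "\<And>X. X \<in> Obj (SCTop S) \<Longrightarrow> homeomorphic_map X (on_obj F X) (\<alpha> X)"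
    and \<beta>: "\<And>X. X \<in> Obj (SCTop S) \<Longrightarrow> homeomorphic_map X (on_obj G X) (\<beta> X)"
    and nat_\<alpha>: "\<And>X Y f x. X \<in> Obj (SCTop S) \<Longrightarrow> Y \<in> Obj (SCTop S) \<Longrightarrow> f \<in> sc_map X Y \<Longrightarrow>
      x \<in> topspace X \<Longrightarrow> on_hom F X Y f (\<alpha> X x) = \<alpha> Y (f x)"
    and nat_\<beta>: "\<And>X Y f x. X \<in> Obj (SCTop S) \<Longrightarrow> Y \<in> Obj (SCTop S) \<Longrightarrow> f \<in> sc_map X Y \<Longrightarrow>
      x \<in> topspace X \<Longrightarrow> on_hom G X Y f (\<beta> X x) = \<beta> Y (f x)"
  shows "nat_isomorphic (SCTop S) (SCTop S') F G"
proof (rule nat_isomorphic_concrete[OF concrete_category_SCTop concrete_category_SCTop F G])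
  fix X :: "'a topology" assume X: "X \<in> Obj (SCTop S)"
  show "bij_betw (\<alpha> X) (topspace X) (topspace (on_obj F X))"
    "bij_betw (\<beta> X) (topspace X) (topspace (on_obj G X))"
    using \<alpha>[OF X] \<beta>[OF X] by (simp_all add: homeomorphic_eq_everything_map bij_betw_def)
  show "(\<lambda>y\<in>topspace (on_obj F X). \<beta> X (inv_into (topspace X) (\<alpha> X) y)) \<in>
      Hom (SCTop S') (on_obj F X) (on_obj G X)"
    using homeomorphic_map_sc_map[OF homeomorphic_map_compose[OF
        homeomorphic_map_inverse[OF \<alpha>[OF X]] \<beta>[OF X]]]
    by (simp add: SCTop_def comp_def)
  show "(\<lambda>y\<in>topspace (on_obj G X). \<alpha> X (inv_into (topspace X) (\<beta> X) y)) \<in>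
      Hom (SCTop S') (on_obj G X) (on_obj F X)"
    using homeomorphic_map_sc_map[OF homeomorphic_map_compose[OF
        homeomorphic_map_inverse[OF \<beta>[OF X]] \<alpha>[OF X]]]
    by (simp add: SCTop_def comp_def)
next
  fix X Y :: "'a topology" and f x
  assume X: "X \<in> Obj (SCTop S)" and Y: "Y \<in> Obj (SCTop S)"
    and "f \<in> Hom (SCTop S) X Y" and x: "x \<in> topspace X"
  then have f: "f \<in> sc_map X Y"
    by (simp add: SCTop_def)
  show "on_hom F X Y f (\<alpha> X x) = \<alpha> Y (f x)"
    by (rule nat_\<alpha>[OF X Y f x])
  show "on_hom G X Y f (\<beta> X x) = \<beta> Y (f x)"
    by (rule nat_\<beta>[OF X Y f x])
qed

text \<open>Taking preimages commutes with transport. Applied to open sets and to filters, this carries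
  the naturality of the unit and the counit over to the transported functors.\<close>

lemma transport_fun_vimage_image:
  assumes r: "inj_on r A" "inj_on r B" and f: "f \<in> A \<rightarrow> B" and "W \<subseteq> B"
  shows "transport_fun r A f -` r ` W \<inter> r ` A = r ` (f -` W \<inter> A)"
proof (intro equalityI subsetI)
  fix y assume "y \<in> transport_fun r A f -` r ` W \<inter> r ` A"
  then obtain x where x: "x \<in> A" "y = r x" "r (f x) \<in> r ` W"
    using transport_fun_apply[OF r(1)] by auto
  then have "f x \<in> W"
    using inj_on_image_mem_iff[OF r(2) _ \<open>W \<subseteq> B\<close>, of "f x"] f by auto
  then show "y \<in> r ` (f -` W \<inter> A)"
    using x by blast
next
  fix y assume "y \<in> r ` (f -` W \<inter> A)"
  then show "y \<in> transport_fun r A f -` r ` W \<inter> r ` A"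
    using transport_fun_apply[OF r(1)] by auto
qed

lemma on_obj_comp_functor: "on_obj (G \<circ>\<^sub>F F) X = on_obj G (on_obj F X)"
  by (simp add: comp_functor_def)

lemma on_hom_comp_functor:
  "on_hom (G \<circ>\<^sub>F F) X Y f = on_hom G (on_obj F X) (on_obj F Y) (on_hom F X Y f)"
  by (simp add: comp_functor_def)

lemma op_functor_simps:
  "on_obj (op_functor F) = on_obj F"
  "on_hom (op_functor F) X Y = on_hom F Y X"
  by (simp_all add: op_functor_def)

lemma on_hom_transport:
  "on_hom (transport_MSLat r) M N = transport_fun r (carrier M)"
  "on_hom (transport_SCTop r) X Y = transport_fun r (topspace X)"
  by (simp_all add: transport_MSLat_def transport_SCTop_def)

lemma carrier_transport: "carrier (on_obj (transport_MSLat r) M) = r ` carrier M"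
  by (simp add: transport_MSLat_def)

text \<open>On a universe of small sets both round trips are isomorphic to the identity, by the unit and
  the counit followed by transport along the coding \<open>e\<close> of small sets.\<close>

context
  fixes S :: "'u set set" and e :: "'u set \<Rightarrow> 'u"
  assumes S: "small_universe S e"
begin

lemma small_universe_powerset:
  assumes "A \<in> S" "\<A> \<subseteq> Pow A"
  shows "inj_on e \<A>" "e ` \<A> \<in> S"
proof -
  have "inj_on e S" "Pow A \<subseteq> S" "e ` Pow A \<in> S"
    using S assms(1) by (simp_all add: small_universe_def)
  then have "Pow (e ` Pow A) \<subseteq> S"
    using S by (simp add: small_universe_def)
  then show "e ` \<A> \<in> S"
    using image_mono[OF assms(2), of e] by blast
  show "inj_on e \<A>"
    by (rule inj_on_subset[OF \<open>inj_on e S\<close> subset_trans[OF assms(2) \<open>Pow A \<subseteq> S\<close>]])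
qed

lemma small_filters:
  assumes "carrier M \<in> S"
  shows "inj_on e (filters M)" "e ` filters M \<in> S"
  using small_universe_powerset[OF assms, of "filters M"] filters_subset[of _ M] by auto

lemma small_supercompact_opens:
  assumes "topspace X \<in> S"
  shows "inj_on e {U. supercompact_open X U}" "e ` {U. supercompact_open X U} \<in> S"
  using small_universe_powerset[OF assms, of "{U. supercompact_open X U}"]
    supercompact_open_subset[of X] by auto

lemma is_functor_small_A_tilde:
  "is_functor (opposite (MSLat S)) (SCTop S) (transport_SCTop e \<circ>\<^sub>F A_tilde)"
proof (rule is_functor_comp)
  \<comment> \<open>Spaces of filters need not have small underlying sets before transport; what transport
    needs is that \<open>e\<close> is injective on them and has small image.\<close>
  let ?S' = "filters ` {M :: 'u gorder. carrier M \<in> S}"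
  show "is_functor (opposite (MSLat S)) (SCTop ?S') A_tilde"
    by (rule is_functor_A_tilde) blast
  show "is_functor (SCTop ?S') (SCTop S) (transport_SCTop e)"
    using small_filters by (intro is_functor_transport_SCTop) auto
qed

lemma is_functor_small_I_tilde:
  "is_functor (SCTop S) (opposite (MSLat S)) (op_functor (transport_MSLat e) \<circ>\<^sub>F I_tilde)"
proof (rule is_functor_comp)
  let ?S' = "(\<lambda>X. {U. supercompact_open X U}) ` {X :: 'u topology. topspace X \<in> S}"
  show "is_functor (SCTop S) (opposite (MSLat ?S')) I_tilde"
    by (rule is_functor_I_tilde) blast
  show "is_functor (opposite (MSLat ?S')) (opposite (MSLat S)) (op_functor (transport_MSLat e))"
    using small_supercompact_opens by (intro is_functor_op is_functor_transport_MSLat) auto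
qed

lemma nat_isomorphic_small_unit:
  "nat_isomorphic (opposite (MSLat S)) (opposite (MSLat S)) id_functor
    ((op_functor (transport_MSLat e) \<circ>\<^sub>F I_tilde) \<circ>\<^sub>F (transport_SCTop e \<circ>\<^sub>F A_tilde))"
  (is "nat_isomorphic _ _ _ ?GF")
proof -
  let ?X = "\<lambda>M. on_obj (transport_SCTop e) (filter_space M)"
  let ?\<alpha> = "\<lambda>M x. e (e ` filters_containing M x)"
  have GF: "is_functor (opposite (MSLat S)) (opposite (MSLat S)) ?GF"
    by (rule is_functor_comp[OF is_functor_small_A_tilde is_functor_small_I_tilde])
  have GF_obj: "on_obj ?GF M = on_obj (transport_MSLat e) (supercompact_poset (?X M))" for M
    by (simp add: on_obj_comp_functor op_functor_simps A_tilde_simps I_tilde_simps)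
  have objD: "meet_semilattice M" "carrier M \<in> S" if "M \<in> Obj (MSLat S)" for M
    using that by (simp_all add: MSLat_def)
  have eX: "homeomorphic_map (filter_space M) (?X M) e" if "M \<in> Obj (MSLat S)" for M
    using homeomorphic_map_transport[of e "filter_space M"] small_filters(1)[OF objD(2)[OF that]]
    by (simp add: topspace_filter_space[OF objD(1)[OF that]])
  have X: "topspace (?X M) = e ` filters M" if "M \<in> Obj (MSLat S)" for M
    using homeomorphic_imp_surjective_map[OF eX[OF that]]
    by (simp add: topspace_filter_space[OF objD(1)[OF that]])
  have inj: "inj_on e {U. supercompact_open (?X M) U}" if "M \<in> Obj (MSLat S)" for M
    using small_supercompact_opens(1)[of "?X M"] X[OF that] small_filters(2)[OF objD(2)[OF that]]
    by simp
  have U: "poset_iso M (supercompact_poset (?X M)) ((`) e \<circ> filters_containing M)"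
    if "M \<in> Obj (MSLat S)" for M
    by (rule poset_iso_comp[OF poset_iso_filters_containing[OF objD(1)[OF that]]
          poset_iso_supercompact_poset[OF eX[OF that]]])
  then have sc: "supercompact_open (?X M) (e ` filters_containing M x)"
    if "M \<in> Obj (MSLat S)" "x \<in> carrier M" for M x
    using poset_iso_carrier[OF U[OF that(1)] that(2)] by simp
  \<comment> \<open>The opposite of \<open>MSLat S\<close> is not concrete, so the isomorphism is built in \<open>MSLat S\<close> and
    reversed afterwards.\<close>
  have "nat_isomorphic (MSLat S) (MSLat S) (op_functor ?GF) id_functor"
  proof (rule nat_isomorphic_MSLat[where \<alpha> = ?\<alpha> and \<beta> = "\<lambda>M x. x"])
    show "is_functor (MSLat S) (MSLat S) (op_functor ?GF)"
      using is_functor_op[OF GF] by (simp add: opposite_opposite)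
    show "is_functor (MSLat S) (MSLat S) id_functor"
      by (intro is_functor_id is_category_concrete[OF concrete_category_MSLat])
  next
    fix M assume M: "M \<in> Obj (MSLat S)"
    have "poset_iso (supercompact_poset (?X M)) (on_obj ?GF M) e"
      unfolding GF_obj by (rule poset_iso_transport) (simp add: inj[OF M])
    then show "poset_iso M (on_obj (op_functor ?GF) M) (?\<alpha> M)"
      using poset_iso_comp[OF U[OF M]] by (simp add: op_functor_simps comp_def)
    show "poset_iso M (on_obj id_functor M) (\<lambda>x. x)"
      by (simp add: poset_iso_def id_functor_def bij_betw_def)
  next
    fix M N f x
    assume M: "M \<in> Obj (MSLat S)" and N: "N \<in> Obj (MSLat S)" and f: "f \<in> mslat_hom M N"
      and x: "x \<in> carrier M"
    let ?a = "\<lambda>F\<in>filters N. f -` F \<inter> carrier M"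
    let ?i = "on_hom I_tilde (?X N) (?X M) (transport_fun e (filters N) ?a)"
    have "transport_fun e (filters N) ?a -` e ` filters_containing M x \<inter> e ` filters N =
        e ` (?a -` filters_containing M x \<inter> filters N)"
      by (rule transport_fun_vimage_image[where B = "filters M"])
        (use small_filters(1)[OF objD(2)[OF M]] small_filters(1)[OF objD(2)[OF N]]
          filters_vimage[OF objD(1)[OF M] objD(1)[OF N] f] in \<open>auto simp: filters_containing_def\<close>)
    also have "\<dots> = e ` filters_containing N (f x)"
      using vimage_filters_containing[OF objD(1)[OF M] objD(1)[OF N] f x] by simp
    finally have "?i (e ` filters_containing M x) = e ` filters_containing N (f x)"
      using sc[OF M x] X[OF N] by (simp add: I_tilde_simps)
    moreover have "on_hom (op_functor ?GF) M N f = transport_fun e {U. supercompact_open (?X M) U} ?i"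
      by (simp add: op_functor_simps on_hom_comp_functor on_obj_comp_functor on_hom_transport
          A_tilde_simps I_tilde_simps(1) topspace_filter_space[OF objD(1)[OF N]])
    ultimately show "on_hom (op_functor ?GF) M N f (?\<alpha> M x) = ?\<alpha> N (f x)"
      using transport_fun_apply[OF inj[OF M]] sc[OF M x] by simp
  qed (simp add: id_functor_def)
  then have "nat_isomorphic (opposite (MSLat S)) (opposite (MSLat S))
      (op_functor id_functor) (op_functor (op_functor ?GF))"
    by (rule nat_isomorphic_op)
  then show ?thesis
    by (simp add: op_functor_op_functor op_functor_id)
qed

lemma nat_isomorphic_small_counit:
  "nat_isomorphic (SCTop S) (SCTop S)
    ((transport_SCTop e \<circ>\<^sub>F A_tilde) \<circ>\<^sub>F (op_functor (transport_MSLat e) \<circ>\<^sub>F I_tilde)) id_functor"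
  (is "nat_isomorphic _ _ ?FG _")
proof -
  let ?M = "\<lambda>X. on_obj (transport_MSLat e) (supercompact_poset X)"
  let ?\<alpha> = "\<lambda>X p. e (e ` supercompact_nhds X p)"
  have FG_obj: "on_obj ?FG X = on_obj (transport_SCTop e) (filter_space (?M X))" for X
    by (simp add: on_obj_comp_functor op_functor_simps A_tilde_simps I_tilde_simps)
  have objD: "sc_space X" "topspace X \<in> S" if "X \<in> Obj (SCTop S)" for X
    using that by (simp_all add: SCTop_def)
  have inj_sc: "inj_on e {U. supercompact_open X U}" if "X \<in> Obj (SCTop S)" for X
    by (rule small_supercompact_opens(1)[OF objD(2)[OF that]])
  have eM: "poset_iso (supercompact_poset X) (?M X) e" if "X \<in> Obj (SCTop S)" for X
    by (rule poset_iso_transport) (simp add: inj_sc[OF that])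
  have P: "meet_semilattice (supercompact_poset X)" if "X \<in> Obj (SCTop S)" for X
    by (rule meet_semilattice_supercompact_poset[OF objD(1)[OF that]])
  have M: "meet_semilattice (?M X)" "carrier (?M X) \<in> S" if "X \<in> Obj (SCTop S)" for X
    using meet_semilattice_transport[OF P[OF that], of e] inj_sc[OF that]
      small_supercompact_opens(2)[OF objD(2)[OF that]]
    by (simp_all add: carrier_transport)
  have inj: "inj_on e (filters (?M X))" if "X \<in> Obj (SCTop S)" for X
    by (rule small_filters(1)[OF M(2)[OF that]])
  have V: "homeomorphic_map X (filter_space (?M X)) ((`) e \<circ> supercompact_nhds X)"
    if "X \<in> Obj (SCTop S)" for X
    by (rule homeomorphic_map_compose[OF homeomorphic_map_supercompact_nhds[OF objD(1)[OF that]]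
          homeomorphic_map_filter_space[OF P[OF that] M(1)[OF that] eM[OF that]]])
  then have fil: "e ` supercompact_nhds X p \<in> filters (?M X)"
    if "X \<in> Obj (SCTop S)" "p \<in> topspace X" for X p
    using homeomorphic_imp_surjective_map[OF V[OF that(1)]] that(2)
    by (auto simp: topspace_filter_space[OF M(1)[OF that(1)]])
  show ?thesis
  proof (rule nat_isomorphic_SCTop[where \<alpha> = ?\<alpha> and \<beta> = "\<lambda>X p. p"])
    show "is_functor (SCTop S) (SCTop S) ?FG"
      by (rule is_functor_comp[OF is_functor_small_I_tilde is_functor_small_A_tilde])
    show "is_functor (SCTop S) (SCTop S) id_functor"
      by (intro is_functor_id is_category_concrete[OF concrete_category_SCTop])
  next
    fix X assume X: "X \<in> Obj (SCTop S)"
    have "homeomorphic_map (filter_space (?M X)) (on_obj ?FG X) e"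
      unfolding FG_obj
      by (rule homeomorphic_map_transport) (simp add: topspace_filter_space[OF M(1)[OF X]] inj[OF X])
    then show "homeomorphic_map X (on_obj ?FG X) (?\<alpha> X)"
      using homeomorphic_map_compose[OF V[OF X]] by (simp add: comp_def)
    show "homeomorphic_map X (on_obj id_functor X) (\<lambda>p. p)"
      using homeomorphic_map_id[of X X] by (simp add: id_functor_def id_def)
  next
    fix X Y f p
    assume X: "X \<in> Obj (SCTop S)" and Y: "Y \<in> Obj (SCTop S)" and f: "f \<in> sc_map X Y"
      and p: "p \<in> topspace X"
    let ?i = "\<lambda>U\<in>{U. supercompact_open Y U}. f -` U \<inter> topspace X"
    let ?t = "transport_fun e {U. supercompact_open Y U} ?i"
    let ?a = "on_hom A_tilde (?M X) (?M Y) ?t"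
    have "?t -` e ` supercompact_nhds X p \<inter> e ` {U. supercompact_open Y U} =
        e ` (?i -` supercompact_nhds X p \<inter> {U. supercompact_open Y U})"
      by (rule transport_fun_vimage_image[where B = "{U. supercompact_open X U}"])
        (use inj_sc[OF X] inj_sc[OF Y] f in \<open>auto simp: supercompact_nhds_def sc_map_def\<close>)
    also have "\<dots> = e ` supercompact_nhds Y (f p)"
      using vimage_supercompact_nhds[OF f p] by simp
    finally have "?a (e ` supercompact_nhds X p) = e ` supercompact_nhds Y (f p)"
      using fil[OF X p] by (simp add: A_tilde_simps carrier_transport)
    moreover have "on_hom ?FG X Y f = transport_fun e (filters (?M X)) ?a"
      by (simp add: op_functor_simps on_hom_comp_functor on_obj_comp_functor on_hom_transport
          A_tilde_simps(1) I_tilde_simps topspace_filter_space[OF M(1)[OF X]])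
    ultimately show "on_hom ?FG X Y f (?\<alpha> X p) = ?\<alpha> Y (f p)"
      using transport_fun_apply[OF inj[OF X]] fil[OF X p] by simp
  qed (simp add: id_functor_def)
qed

end

theorem theorem4p7:
  fixes S :: "'u set set" and e :: "'u set \<Rightarrow> 'u"
  shows
    "is_functor (opposite (MSLat (UNIV :: 'a set set))) (SCTop UNIV) A_tilde \<and>
     is_functor (SCTop (UNIV :: 'b set set)) (opposite (MSLat UNIV)) I_tilde \<and>
     nat_isomorphic (opposite (MSLat (UNIV :: 'a set set))) (opposite (MSLat UNIV))
       (op_functor (transport_MSLat (\<lambda>x. {{x}}))) (I_tilde \<circ>\<^sub>F A_tilde) \<and>
     nat_isomorphic (SCTop (UNIV :: 'b set set)) (SCTop UNIV)
       (A_tilde \<circ>\<^sub>F I_tilde) (transport_SCTop (\<lambda>x. {{x}})) \<and>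
     (small_universe S e \<longrightarrow>
       equivalence_via (opposite (MSLat S)) (SCTop S)
         (transport_SCTop e \<circ>\<^sub>F A_tilde) (op_functor (transport_MSLat e) \<circ>\<^sub>F I_tilde))"
proof (intro conjI impI)
  show A: "is_functor (opposite (MSLat (UNIV :: 'a set set))) (SCTop UNIV) A_tilde"
    by (rule is_functor_A_tilde) simp
  show I: "is_functor (SCTop (UNIV :: 'b set set)) (opposite (MSLat UNIV)) I_tilde"
    by (rule is_functor_I_tilde) simp
  show "nat_isomorphic (opposite (MSLat (UNIV :: 'a set set))) (opposite (MSLat UNIV))
      (op_functor (transport_MSLat (\<lambda>x. {{x}}))) (I_tilde \<circ>\<^sub>F A_tilde)"
  proof -
    let ?r = "\<lambda>x :: 'a. {{x}}"
    let ?IA = "I_tilde \<circ>\<^sub>F A_tilde :: ('a gorder, 'a \<Rightarrow> 'a, 'a set set gorder, _) funct"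
    have inj: "inj_on ?r A" for A
      by (simp add: inj_on_def)
    have IA: "is_functor (opposite (MSLat UNIV)) (opposite (MSLat UNIV)) ?IA"
      by (rule is_functor_comp[OF A is_functor_I_tilde]) simp
    have "nat_isomorphic (MSLat UNIV) (MSLat UNIV) (op_functor ?IA) (transport_MSLat ?r)"
    proof (rule nat_isomorphic_MSLat[where \<alpha> = filters_containing and \<beta> = "\<lambda>_. ?r"])
      show "is_functor (MSLat UNIV) (MSLat UNIV) (op_functor ?IA)"
        using is_functor_op[OF IA] by (simp add: opposite_opposite)
      show "is_functor (MSLat UNIV) (MSLat UNIV) (transport_MSLat ?r)"
        using inj by (intro is_functor_transport_MSLat) simp_all
    next
      fix M :: "'a gorder" assume "M \<in> Obj (MSLat UNIV)"
      then show "poset_iso M (on_obj (op_functor ?IA) M) (filters_containing M)"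
        using poset_iso_filters_containing[of M]
        by (simp add: MSLat_def op_functor_simps on_obj_comp_functor A_tilde_simps I_tilde_simps)
      show "poset_iso M (on_obj (transport_MSLat ?r) M) ?r"
        by (rule poset_iso_transport[OF inj])
    next
      fix M N :: "'a gorder" and f x
      assume "M \<in> Obj (MSLat UNIV)" "N \<in> Obj (MSLat UNIV)" and f: "f \<in> mslat_hom M N"
        and x: "x \<in> carrier M"
      then have M: "meet_semilattice M" and N: "meet_semilattice N"
        by (simp_all add: MSLat_def)
      show "on_hom (op_functor ?IA) M N f (filters_containing M x) = filters_containing N (f x)"
        using vimage_filters_containing[OF M N f x] x
        by (simp add: op_functor_simps on_hom_comp_functor A_tilde_simps I_tilde_simps
            topspace_filter_space[OF N] supercompact_open_filter_space_iff[OF M])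
      show "on_hom (transport_MSLat ?r) M N f {{x}} = {{f x}}"
        using transport_fun_apply[OF inj x] by (simp add: on_hom_transport)
    qed
    from nat_isomorphic_op[OF this] show ?thesis
      by (simp add: op_functor_op_functor)
  qed
  show "nat_isomorphic (SCTop (UNIV :: 'b set set)) (SCTop UNIV)
      (A_tilde \<circ>\<^sub>F I_tilde) (transport_SCTop (\<lambda>x. {{x}}))"
  proof -
    let ?r = "\<lambda>x :: 'b. {{x}}"
    have inj: "inj_on ?r A" for A
      by (simp add: inj_on_def)
    show ?thesis
    proof (rule nat_isomorphic_SCTop[where \<alpha> = supercompact_nhds and \<beta> = "\<lambda>_. ?r"])
      show "is_functor (SCTop (UNIV :: 'b set set)) (SCTop UNIV) (A_tilde \<circ>\<^sub>F I_tilde)"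
        by (rule is_functor_comp[OF I is_functor_A_tilde]) simp
      show "is_functor (SCTop UNIV) (SCTop UNIV) (transport_SCTop ?r)"
        using inj by (intro is_functor_transport_SCTop) simp_all
    next
      fix X :: "'b topology" assume "X \<in> Obj (SCTop UNIV)"
      then show "homeomorphic_map X (on_obj (A_tilde \<circ>\<^sub>F I_tilde) X) (supercompact_nhds X)"
        using homeomorphic_map_supercompact_nhds[of X]
        by (simp add: SCTop_def on_obj_comp_functor A_tilde_simps I_tilde_simps)
      show "homeomorphic_map X (on_obj (transport_SCTop ?r) X) ?r"
        by (rule homeomorphic_map_transport[OF inj])
    next
      fix X Y :: "'b topology" and f p
      assume X: "X \<in> Obj (SCTop UNIV)" and "Y \<in> Obj (SCTop UNIV)" and f: "f \<in> sc_map X Y"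
        and p: "p \<in> topspace X"
      have "supercompact_nhds X p \<in> filters (supercompact_poset X)"
        using supercompact_nhds_filter[OF _ p] X by (simp add: SCTop_def)
      then show "on_hom (A_tilde \<circ>\<^sub>F I_tilde) X Y f (supercompact_nhds X p) = supercompact_nhds Y (f p)"
        using vimage_supercompact_nhds[OF f p]
        by (simp add: on_hom_comp_functor A_tilde_simps I_tilde_simps)
      show "on_hom (transport_SCTop ?r) X Y f {{p}} = {{f p}}"
        using transport_fun_apply[OF inj p] by (simp add: on_hom_transport)
    qed
  qed
  assume "small_universe S e"
  then show "equivalence_via (opposite (MSLat S)) (SCTop S)
      (transport_SCTop e \<circ>\<^sub>F A_tilde) (op_functor (transport_MSLat e) \<circ>\<^sub>F I_tilde)"
    unfolding equivalence_via_def
    by (intro conjI is_functor_small_A_tilde is_functor_small_I_tilde nat_isomorphic_small_unit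
        nat_isomorphic_small_counit)
qed

end
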